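(* Put $\mu_s(n)=(q^s-1)\dfrac{q^{n-s+1}-1}{(q-1)^2}$. Then: (i) for $0\le r\le n$ and $0\le s\le\min(r,n-r)$, every $\varphi\in\mathrm{V}_{r,s}$ satisfies $\mathcal{L}_r\varphi=-\mu_s(n)\varphi$; (ii) for $0\le r_1,r_2\le n$ and $0\le s\le\mathrm{N}(r_1,r_2)$, $\mathcal{L}_{r_1,r_2}\Lambda_s^{r_1,r_2}+\mu_s(n)\Lambda_s^{r_1,r_2}=0$; (iii) the unique polynomial $f_s^{r_1,r_2}$ of degree at most $\mathrm{N}(r_1,r_2)$ with $f_s^{r_1,r_2}(q^{-t})=\lambda_s^{r_1,r_2}(t)$ for all $t\in\mathrm{I}_n(r_1,r_2)$ has degree $s$ and satisfies each of the identities $$f_s^{r_1,r_2}(u)=f_s^{r_1,r_2}(1)\,{}_3\phi_2\!\left(\begin{matrix}q^s,\,u^{-1},\,q^{n-s+1}\\ q^{n-r_1},\,q^{r_2}\end{matrix};q^{-1},\,q^{r_2-r_1-1}u\right),$$ $$f_s^{r_1,r_2}(u)=f_s^{r_1,r_2}(q^{-r_2})\,{}_3\phi_2\!\left(\begin{matrix}q^s,\,q^{r_2}u,\,q^{n-s+1}\\ q^{r_1},\,q^{r_2}\end{matrix};q^{-1},\,q^{-1}\right),$$ $$f_s^{r_1,r_2}(u)=f_s^{r_1,r_2}(q^{r_1-n})\,{}_3\phi_2\!\left(\begin{matrix}q^s,\,q^{n-r_1}u,\,q^{n-s+1}\\ q^{n-r_1},\,q^{n-r_2}\end{matrix};q^{-1},\,q^{-1}\right),$$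 $$f_s^{r_1,r_2}(u)=f_s^{r_1,r_2}(q^{r_1-r_2})\,{}_3\phi_2\!\left(\begin{matrix}q^s,\,q^{r_1-r_2}u^{-1},\,q^{n-s+1}\\ q^{r_1},\,q^{n-r_2}\end{matrix};q^{-1},\,q^{-1}u\right).$$
   Context: Let $q$ be a prime power, $\Omega$ an $n$-dimensional vector space over $\mathbb{F}_q$, $\mathrm{G}=\mathrm{GL}(\Omega)$, $\mathrm{X}_r$ the set of $r$-dimensional subspaces, $\partial(x,y)=\dim(x/(x\cap y))$, $\mathrm{V}_r$ the Hilbert space of functions $\mathrm{X}_r\to\mathbb{C}$ with $\mathrm{G}$ acting by $(\rho_r(g)\varphi)(x)=\varphi(g^{-1}x)$. $\mathrm{N}(r_1,r_2)=\min(r_1,r_2,n-r_1,n-r_2)$, $\mathrm{I}_n(r_1,r_2)=\{t\in\mathbb{Z}:\max(0,r_2-r_1)\le t\le\min(r_2,n-r_1)\}$. $\mathrm{G}$-equivariant maps $\Lambda:\mathrm{V}_{r_1}\to\mathrm{V}_{r_2}$ are exactly those of the form $\Lambda\varphi(x_2)=\sum_{x_1}\lambda(\partial(x_2,x_1))\varphi(x_1)$ with $\lambda:\mathrm{I}_n(r_1,r_2)\to\mathbb{C}$ (the kernel). There are pairwise inequivalent irreducible representations $\pi_s$ of $\mathrm{G}$ with orthogonal decompositions into irreducible invariant subspaces $\mathrm{V}_r=\bigoplus_{s=0}^{\min(r,n-r)}\mathrm{V}_{r,s}$, $\mathrm{V}_{r,s}\simeq\pi_s$. For $0\le s\le\mathrm{N}(r_1,r_2)$,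 $\Lambda_s^{r_1,r_2}$ is a nonzero equivariant map $\mathrm{V}_{r_1,s}\to\mathrm{V}_{r_2,s}$ (any fixed choice), extended by $0$ on the orthogonal complement of $\mathrm{V}_{r_1,s}$, with kernel $\lambda_s^{r_1,r_2}$. The graph Laplacian $\mathcal{L}_r:\mathrm{V}_r\to\mathrm{V}_r$ is $\mathcal{L}_r\varphi(x)=\sum_{y\in\mathrm{X}_r,\ \partial(x,y)=1}(\varphi(y)-\varphi(x))$, and $\mathcal{L}_{r_1,r_2}\Lambda=\mathcal{L}_{r_2}\circ\Lambda$ for $\Lambda:\mathrm{V}_{r_1}\to\mathrm{V}_{r_2}$. Notation: $(u;p)_k=\prod_{j=0}^{k-1}(1-p^ju)$, $(u_1,\dots,u_d;p)_k=\prod_i(u_i;p)_k$, and ${}_3\phi_2\!\left(\begin{smallmatrix}a_1,a_2,a_3\\ b_1,b_2\end{smallmatrix};p,z\right)=\sum_{k\ge0}\frac{(a_1,a_2,a_3;p)_k}{(p,b_1,b_2;p)_k}z^k$; with $a_1=q^s$ and $p=q^{-1}$ the series terminates at $k=s$. *)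

theory Defs
  imports
    Complex_Main
    "HOL-Library.Cardinality"
    "HOL-Library.Function_Algebras"
    "HOL-Computational_Algebra.Polynomial"
begin

section \<open>Complex function spaces and representations\<close>

text \<open>
  Complex vector spaces are taken to be subspaces of a space of functions
  \<open>'i \<Rightarrow> complex\<close>, with the pointwise addition of \<open>HOL-Library.Function_Algebras\<close> and the
  following scaling. A linear map between two such subspaces is a total HOL function of which
  only the values on the source subspace matter.
\<close>

definition cscale :: "complex \<Rightarrow> ('i \<Rightarrow> complex) \<Rightarrow> 'i \<Rightarrow> complex" where
  "cscale c f = (\<lambda>i. c * f i)"

interpretation cfun: vector_space cscale
  by unfold_locales (auto simp: cscale_def fun_eq_iff algebra_simps)

definition lin_map ::
  "('i \<Rightarrow> complex) set \<Rightarrow> ('j \<Rightarrow> complex) set \<Rightarrow> (('i \<Rightarrow> complex) \<Rightarrow> ('j \<Rightarrow> complex)) \<Rightarrow> bool" where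
  "lin_map U W T \<longleftrightarrow>
     (\<forall>u\<in>U. T u \<in> W) \<and>
     (\<forall>u\<in>U. \<forall>v\<in>U. T (u + v) = T u + T v) \<and>
     (\<forall>c. \<forall>u\<in>U. T (cscale c u) = cscale c (T u))"

text \<open>Here \<open>G\<close> is a group of permutations under composition.\<close>

definition representation ::
  "('v \<Rightarrow> 'v) set \<Rightarrow> ('i \<Rightarrow> complex) set \<Rightarrow> (('v \<Rightarrow> 'v) \<Rightarrow> ('i \<Rightarrow> complex) \<Rightarrow> ('i \<Rightarrow> complex)) \<Rightarrow> bool" where
  "representation G U \<pi> \<longleftrightarrow>
     cfun.subspace U \<and>
     (\<forall>g\<in>G. lin_map U U (\<pi> g)) \<and>
     (\<forall>u\<in>U. \<pi> id u = u) \<and>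
     (\<forall>g\<in>G. \<forall>h\<in>G. \<forall>u\<in>U. \<pi> (g \<circ> h) u = \<pi> g (\<pi> h u))"

definition irreducible_rep ::
  "('v \<Rightarrow> 'v) set \<Rightarrow> ('i \<Rightarrow> complex) set \<Rightarrow> (('v \<Rightarrow> 'v) \<Rightarrow> ('i \<Rightarrow> complex) \<Rightarrow> ('i \<Rightarrow> complex)) \<Rightarrow> bool" where
  "irreducible_rep G U \<pi> \<longleftrightarrow>
     representation G U \<pi> \<and> U \<noteq> {0} \<and>
     (\<forall>W. cfun.subspace W \<and> W \<subseteq> U \<and> (\<forall>g\<in>G. \<forall>w\<in>W. \<pi> g w \<in> W) \<longrightarrow> W = {0} \<or> W = U)"

definition equivariant ::
  "('v \<Rightarrow> 'v) set \<Rightarrow>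
   ('i \<Rightarrow> complex) set \<Rightarrow> (('v \<Rightarrow> 'v) \<Rightarrow> ('i \<Rightarrow> complex) \<Rightarrow> ('i \<Rightarrow> complex)) \<Rightarrow>
   ('j \<Rightarrow> complex) set \<Rightarrow> (('v \<Rightarrow> 'v) \<Rightarrow> ('j \<Rightarrow> complex) \<Rightarrow> ('j \<Rightarrow> complex)) \<Rightarrow>
   (('i \<Rightarrow> complex) \<Rightarrow> ('j \<Rightarrow> complex)) \<Rightarrow> bool" where
  "equivariant G U \<pi> W \<sigma> T \<longleftrightarrow>
     lin_map U W T \<and> (\<forall>g\<in>G. \<forall>u\<in>U. T (\<pi> g u) = \<sigma> g (T u))"

definition equivalent_rep ::
  "('v \<Rightarrow> 'v) set \<Rightarrow>
   ('i \<Rightarrow> complex) set \<Rightarrow> (('v \<Rightarrow> 'v) \<Rightarrow> ('i \<Rightarrow> complex) \<Rightarrow> ('i \<Rightarrow> complex)) \<Rightarrow>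
   ('j \<Rightarrow> complex) set \<Rightarrow> (('v \<Rightarrow> 'v) \<Rightarrow> ('j \<Rightarrow> complex) \<Rightarrow> ('j \<Rightarrow> complex)) \<Rightarrow> bool" where
  "equivalent_rep G U \<pi> W \<sigma> \<longleftrightarrow> (\<exists>T. equivariant G U \<pi> W \<sigma> T \<and> bij_betw T U W)"


section \<open>The Grassmannians of a vector space and their function spaces\<close>

text \<open>The vector space \<open>\<Omega>\<close> is the whole type \<open>'v\<close>, with scalar multiplication \<open>smul\<close>.\<close>

definition GL :: "('k::field \<Rightarrow> 'v::ab_group_add \<Rightarrow> 'v) \<Rightarrow> ('v \<Rightarrow> 'v) set" where
  "GL smul = {g. Vector_Spaces.linear smul smul g \<and> bij g}"

definition Gr :: "('k::field \<Rightarrow> 'v::ab_group_add \<Rightarrow> 'v) \<Rightarrow> nat \<Rightarrow> 'v set set" where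
  "Gr smul r = {x. module.subspace smul x \<and> vector_space.dim smul x = r}"

text \<open>The dimension of the quotient \<open>x / (x \<inter> y)\<close>; the subtraction never truncates when
  \<open>\<Omega>\<close> is finite-dimensional.\<close>

definition gdist :: "('k::field \<Rightarrow> 'v::ab_group_add \<Rightarrow> 'v) \<Rightarrow> 'v set \<Rightarrow> 'v set \<Rightarrow> nat" where
  "gdist smul x y = vector_space.dim smul x - vector_space.dim smul (x \<inter> y)"

text \<open>Functions on \<open>Gr smul r\<close> are represented by their extension by zero to all sets.\<close>

definition VV :: "('k::field \<Rightarrow> 'v::ab_group_add \<Rightarrow> 'v) \<Rightarrow> nat \<Rightarrow> ('v set \<Rightarrow> complex) set" where
  "VV smul r = {\<phi>. \<forall>x. x \<notin> Gr smul r \<longrightarrow> \<phi> x = 0}"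

definition VV_inner ::
  "('k::field \<Rightarrow> 'v::ab_group_add \<Rightarrow> 'v) \<Rightarrow> nat \<Rightarrow> ('v set \<Rightarrow> complex) \<Rightarrow> ('v set \<Rightarrow> complex) \<Rightarrow> complex" where
  "VV_inner smul r \<phi> \<psi> = (\<Sum>x\<in>Gr smul r. \<phi> x * cnj (\<psi> x))"

definition rho :: "('v \<Rightarrow> 'v) \<Rightarrow> ('v set \<Rightarrow> complex) \<Rightarrow> ('v set \<Rightarrow> complex)" where
  "rho g \<phi> = (\<lambda>x. \<phi> (inv g ` x))"

definition NN :: "nat \<Rightarrow> nat \<Rightarrow> nat \<Rightarrow> nat" where
  "NN n r1 r2 = min (min r1 r2) (min (n - r1) (n - r2))"

definition II :: "nat \<Rightarrow> nat \<Rightarrow> nat \<Rightarrow> nat set" where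
  "II n r1 r2 =
     {t. max 0 (int r2 - int r1) \<le> int t \<and> int t \<le> min (int r2) (int n - int r1)}"

text \<open>Only the values of \<open>\<kappa>\<close> on \<open>II n r1 r2\<close>, the set of values of \<open>gdist\<close> on
  \<open>Gr smul r2 \<times> Gr smul r1\<close>, matter.\<close>

definition is_kernel ::
  "('k::field \<Rightarrow> 'v::ab_group_add \<Rightarrow> 'v) \<Rightarrow> nat \<Rightarrow> nat \<Rightarrow>
   (('v set \<Rightarrow> complex) \<Rightarrow> ('v set \<Rightarrow> complex)) \<Rightarrow> (nat \<Rightarrow> complex) \<Rightarrow> bool" where
  "is_kernel smul r1 r2 \<Lambda> \<kappa> \<longleftrightarrow>
     (\<forall>\<phi>\<in>VV smul r1. \<forall>x2\<in>Gr smul r2.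
        \<Lambda> \<phi> x2 = (\<Sum>x1\<in>Gr smul r1. \<kappa> (gdist smul x2 x1) * \<phi> x1))"

definition laplacian ::
  "('k::field \<Rightarrow> 'v::ab_group_add \<Rightarrow> 'v) \<Rightarrow> nat \<Rightarrow> ('v set \<Rightarrow> complex) \<Rightarrow> ('v set \<Rightarrow> complex)" where
  "laplacian smul r \<phi> =
     (\<lambda>x. if x \<in> Gr smul r
          then \<Sum>y\<in>{y\<in>Gr smul r. gdist smul x y = 1}. \<phi> y - \<phi> x
          else 0)"

definition laplacian_op ::
  "('k::field \<Rightarrow> 'v::ab_group_add \<Rightarrow> 'v) \<Rightarrow> nat \<Rightarrow>
   (('v set \<Rightarrow> complex) \<Rightarrow> ('v set \<Rightarrow> complex)) \<Rightarrow> ('v set \<Rightarrow> complex) \<Rightarrow> ('v set \<Rightarrow> complex)" where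
  "laplacian_op smul r2 \<Lambda> = laplacian smul r2 \<circ> \<Lambda>"

text \<open>
  \<open>(U s, \<pi> s)\<close> are the irreducible representations \<open>\<pi>\<^sub>s\<close>, which occur for \<open>s \<le> n / 2\<close>, and
  \<open>W r s\<close> is \<open>V\<^sub>r\<^sub>,\<^sub>s\<close>. The conditions determine \<open>W\<close>: as \<open>\<pi>\<^sub>s\<close> occurs in \<open>V\<^sub>r\<close> exactly
  for \<open>s \<le> min r (n - r)\<close>, they fix the labelling of the constituents.
\<close>

definition grassmann_decomposition ::
  "('k::field \<Rightarrow> 'v::ab_group_add \<Rightarrow> 'v) \<Rightarrow> nat \<Rightarrow>
   (nat \<Rightarrow> ('i \<Rightarrow> complex) set) \<Rightarrow> (nat \<Rightarrow> ('v \<Rightarrow> 'v) \<Rightarrow> ('i \<Rightarrow> complex) \<Rightarrow> ('i \<Rightarrow> complex)) \<Rightarrow>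
   (nat \<Rightarrow> nat \<Rightarrow> ('v set \<Rightarrow> complex) set) \<Rightarrow> bool" where
  "grassmann_decomposition smul n U \<pi> W \<longleftrightarrow>
     (\<forall>s. 2 * s \<le> n \<longrightarrow> irreducible_rep (GL smul) (U s) (\<pi> s)) \<and>
     (\<forall>s s'. 2 * s \<le> n \<and> 2 * s' \<le> n \<and> s \<noteq> s' \<longrightarrow>
        \<not> equivalent_rep (GL smul) (U s) (\<pi> s) (U s') (\<pi> s')) \<and>
     (\<forall>r\<le>n.
        (\<forall>s\<le>min r (n - r).
           W r s \<subseteq> VV smul r \<and>
           irreducible_rep (GL smul) (W r s) rho \<and>
           equivalent_rep (GL smul) (W r s) rho (U s) (\<pi> s)) \<and>
        (\<forall>s\<le>min r (n - r). \<forall>s'\<le>min r (n - r). s \<noteq> s' \<longrightarrow>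
           (\<forall>\<phi>\<in>W r s. \<forall>\<psi>\<in>W r s'. VV_inner smul r \<phi> \<psi> = 0)) \<and>
        VV smul r = {\<Sum>s\<le>min r (n - r). f s | f. \<forall>s\<le>min r (n - r). f s \<in> W r s})"

text \<open>The maps \<open>\<Lambda>\<^sub>s\<close>: nonzero and equivariant from \<open>W1 \<subseteq> V\<close> at level \<open>r1\<close> to \<open>W2 \<subseteq> V\<close> at
  level \<open>r2\<close>, and zero on the orthogonal complement of \<open>W1\<close>.\<close>

definition extended_equivariant ::
  "('k::field \<Rightarrow> 'v::ab_group_add \<Rightarrow> 'v) \<Rightarrow> nat \<Rightarrow> ('v set \<Rightarrow> complex) set \<Rightarrow>
   nat \<Rightarrow> ('v set \<Rightarrow> complex) set \<Rightarrow> (('v set \<Rightarrow> complex) \<Rightarrow> ('v set \<Rightarrow> complex)) \<Rightarrow> bool" where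
  "extended_equivariant smul r1 W1 r2 W2 \<Lambda> \<longleftrightarrow>
     lin_map (VV smul r1) (VV smul r2) \<Lambda> \<and>
     equivariant (GL smul) W1 rho W2 rho \<Lambda> \<and>
     (\<exists>\<phi>\<in>W1. \<Lambda> \<phi> \<noteq> 0) \<and>
     (\<forall>\<phi>\<in>VV smul r1. (\<forall>\<psi>\<in>W1. VV_inner smul r1 \<phi> \<psi> = 0) \<longrightarrow> \<Lambda> \<phi> = 0)"


section \<open>Basic hypergeometric series\<close>

definition qpoch :: "complex \<Rightarrow> complex \<Rightarrow> nat \<Rightarrow> complex" where
  "qpoch u p k = (\<Prod>j<k. 1 - p ^ j * u)"

text \<open>If \<open>a1 = q ^ s\<close> and \<open>p = 1 / q\<close>, the numerators vanish for \<open>k > s\<close>; so do these terms, even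
  where the denominator vanishes too, because \<open>0 / 0 = 0\<close>.\<close>

definition phi32 ::
  "complex \<Rightarrow> complex \<Rightarrow> complex \<Rightarrow> complex \<Rightarrow> complex \<Rightarrow> complex \<Rightarrow> complex \<Rightarrow> complex" where
  "phi32 a1 a2 a3 b1 b2 p z =
     (\<Sum>k. (qpoch a1 p k * qpoch a2 p k * qpoch a3 p k) /
          (qpoch p p k * qpoch b1 p k * qpoch b2 p k) * z ^ k)"

text \<open>Used for \<open>s \<le> n\<close> only.\<close>

definition mu :: "complex \<Rightarrow> nat \<Rightarrow> nat \<Rightarrow> complex" where
  "mu q s n = (q ^ s - 1) * ((q ^ (n - s + 1) - 1) / (q - 1)\<^sup>2)"

end

theory Submission
  imports Defs
begin

text \<open>
  Let \<open>[k] = (q ^ k - 1) / (q - 1)\<close>. Summing over hyperplanes of a subspace (\<open>up\<close>) and over the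
  subspaces in which it is a hyperplane (\<open>down\<close>) gives adjoint equivariant maps between neighbouring
  levels. Two distinct subspaces are adjacent iff they share a hyperplane, and iff they are
  hyperplanes of a common subspace, so both \<open>up \<circ> down\<close> and \<open>down \<circ> up\<close> are the Laplacian plus a
  scalar; hence both maps commute with the Laplacian, \<open>up\<close> is injective below the middle level and
  \<open>down\<close> above it. By Schur's lemma \<open>down\<close> vanishes on \<open>V\<^sub>s\<^sub>,\<^sub>s\<close>, as \<open>\<pi>\<^sub>s\<close> does not occur at level
  \<open>s - 1\<close>, which gives the eigenvalue \<open>- [s] [n - s + 1]\<close> there; \<open>up\<close> and \<open>down\<close> transport it
  to the other \<open>V\<^sub>r\<^sub>,\<^sub>s\<close>.

  Applied to the image of a point mass, the eigenvalue equation becomes a three-term recurrence for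
  the kernel, which determines it up to a factor since the coefficient of the previous value
  vanishes at the first index. In the variable \<open>u = q powi (- t)\<close> it is a q-difference equation. On the
  Newton basis with nodes \<open>a q\<^sup>-\<^sup>j\<close>, \<open>a\<close> one of \<open>1\<close> and \<open>q powi (r1 - r2)\<close>, as well as on the basis of the
  q-shifted factorials of \<open>u / b\<close>, \<open>b\<close> one of \<open>q powi (- r2)\<close> and \<open>q powi (r1 - n)\<close>, the q-difference
  operator is bidiagonal up to the factor \<open>u\<^sup>2\<close>. Each of the four bases therefore yields a polynomial
  solution of degree \<open>s\<close> whose coefficients satisfy a two-term recurrence: these are the four
  series.
\<close>

section \<open>Counting subspaces over a finite field\<close>

text \<open>The q-number \<open>[k]\<close>, written as a geometric sum so that it is a natural
  number and can be a cardinality.\<close>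

definition qnum :: "nat \<Rightarrow> nat \<Rightarrow> nat" where
  "qnum q k = (\<Sum>i<k. q ^ i)"

lemma qnum_0 [simp]: "qnum q 0 = 0"
  and qnum_1 [simp]: "qnum q (Suc 0) = 1"
  by (simp_all add: qnum_def)

lemma power_eq_qnum: "q \<ge> 1 \<Longrightarrow> q ^ k = 1 + (q - 1) * qnum q k"
proof (induction k)
  case (Suc k)
  then obtain p where p: "q = Suc p" by (cases q) auto
  with Suc show ?case by (simp add: qnum_def algebra_simps)
qed (simp add: qnum_def)

lemma qnum_Suc: "qnum q (Suc k) = 1 + q * qnum q k"
  unfolding qnum_def by (subst sum.lessThan_Suc_shift) (simp add: sum_distrib_left)

lemma strict_mono_qnum: "q \<ge> 1 \<Longrightarrow> strict_mono (qnum q)"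
  by (simp add: strict_mono_Suc_iff qnum_def)

lemma of_nat_qnum:
  assumes "q \<ge> 2"
  shows "of_nat (qnum q k) = (of_nat q ^ k - 1) / (of_nat q - 1 :: 'a::field_char_0)"
proof -
  have "of_nat q ^ k = (1 + (of_nat q - 1) * of_nat (qnum q k) :: 'a)"
    using arg_cong[OF power_eq_qnum[of q k], of "of_nat :: nat \<Rightarrow> 'a"] assms
    by (simp add: of_nat_diff)
  moreover have "(of_nat q :: 'a) \<noteq> 1"
    using assms by auto
  ultimately show ?thesis by (simp add: field_simps)
qed

lemma card_field_ge_2: "CARD('k::{field,finite}) \<ge> 2"
proof -
  have "card {0, 1 :: 'k} \<le> CARD('k)" by (intro card_mono) auto
  then show ?thesis by simp
qed

text \<open>Only one of the two cases has to be counted; the other count is the difference to the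
  total. The Laplacian of a radial function is evaluated by two nested uses of this.\<close>

lemma sum_if_two_values:
  fixes f :: "'a \<Rightarrow> complex"
  assumes "finite A" and "\<And>a. a \<in> A \<Longrightarrow> f a = (if P a then b else c)"
  shows "sum f A = of_nat (card {a\<in>A. P a}) * b + (of_nat (card A) - of_nat (card {a\<in>A. P a})) * c"
proof -
  have "sum f A = (\<Sum>a\<in>A. if P a then b else c)" using assms(2) by (intro sum.cong) auto
  also have "\<dots> = (\<Sum>a\<in>A. if P a then b - c else 0) + (\<Sum>a\<in>A. c)"
    unfolding sum.distrib[symmetric] by (intro sum.cong) auto
  also have "(\<Sum>a\<in>A. if P a then b - c else 0) = of_nat (card {a\<in>A. P a}) * (b - c)"
    using assms(1) by (simp add: sum.If_cases Int_def)
  finally show ?thesis by (simp add: algebra_simps)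
qed

locale finite_field_space = finite_dimensional_vector_space scale Basis
  for scale :: "'k::{field,finite} \<Rightarrow> 'v::ab_group_add \<Rightarrow> 'v" (infixr \<open>*s\<close> 75)
    and Basis :: "'v set"
begin

abbreviation n where "n \<equiv> card Basis"

lemma q_ge_2: "CARD('k) \<ge> 2"
  by (rule card_field_ge_2)

section \<open>Sizes of subspaces and finiteness of the ambient space\<close>

lemma card_span_independent:
  assumes "finite B" "independent B"
  shows "card (span B) = CARD('k) ^ card B"
  using assms
proof (induction B rule: finite_induct)
  case (insert b B)
  then have B: "independent B" and b: "b \<notin> span B"
    by (auto simp: independent_insert)
  have "bij_betw (\<lambda>(k, x). k *s b + x) (UNIV \<times> span B) (span (insert b B))"
  proof (rule bij_betw_imageI)
    show "inj_on (\<lambda>(k, x). k *s b + x) (UNIV \<times> span B)"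
    proof (rule inj_onI, clarsimp)
      fix k x l y
      assume x: "x \<in> span B" and y: "y \<in> span B" and eq: "k *s b + x = l *s b + y"
      have "(k - l) *s b = y - x"
      proof -
        have "k *s b = l *s b + y - x" by (simp flip: eq)
        then show ?thesis by (simp add: scale_left_diff_distrib)
      qed
      then have *: "(k - l) *s b \<in> span B"
        using x y span_diff by metis
      have "k = l"
      proof (rule ccontr)
        assume "k \<noteq> l"
        then have "b = inverse (k - l) *s ((k - l) *s b)" by simp
        then show False using span_scale[OF *] b by metis
      qed
      with eq show "k = l \<and> x = y" by simp
    qed
    show "(\<lambda>(k, x). k *s b + x) ` (UNIV \<times> span B) = span (insert b B)"
    proof safe
      fix k x assume "x \<in> span B"
      then show "k *s b + x \<in> span (insert b B)"
        by (metis add_diff_cancel_left' span_breakdown_eq)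
    next
      fix v assume "v \<in> span (insert b B)"
      then obtain k where "v - k *s b \<in> span B" by (auto simp: span_insert)
      then show "v \<in> (\<lambda>(k, x). k *s b + x) ` (UNIV \<times> span B)"
        by (intro image_eqI[of _ _ "(k, v - k *s b)"]) auto
    qed
  qed
  then have "card (span (insert b B)) = CARD('k) * card (span B)"
    by (metis bij_betw_same_card card_cartesian_product)
  with insert B show ?case by simp
qed (simp add: span_empty)

lemma card_subspace:
  assumes "subspace x" shows "card x = CARD('k) ^ dim x"
proof -
  obtain B where B: "B \<subseteq> x" "independent B" "x \<subseteq> span B" "card B = dim x"
    using basis_exists by blast
  then have "span B = x" using assms by (intro span_subspace)
  with card_span_independent[OF finiteI_independent B(2)] B show ?thesis by simp
qed

text \<open>In HOL an infinite set has \<open>card\<close> 0, whereas \<open>card_subspace\<close>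
  gives a positive power of the field size.\<close>

lemma finite_UNIV_space: "finite (UNIV :: 'v set)"
  by (rule card_ge_0_finite) (simp only: card_subspace[OF subspace_UNIV], simp)

lemma finite_set [simp]: "finite (A :: 'v set)"
  using finite_UNIV_space rev_finite_subset by blast

lemma finite_set_set [simp]: "finite (A :: 'v set set)"
  using finite_subset[OF subset_UNIV, of A] finite_Pow_iff[of "UNIV :: 'v set"] finite_UNIV_space
  by (simp only: Pow_UNIV)

section \<open>The covering relation of the subspace lattice, with counts of covers and
  hyperplanes\<close>

definition cov :: "'v set \<Rightarrow> 'v set \<Rightarrow> bool" where
  "cov z w \<longleftrightarrow> subspace z \<and> subspace w \<and> z \<subseteq> w \<and> dim w = Suc (dim z)"

lemma covD:
  assumes "cov z w"
  shows "subspace z" "subspace w" "z \<subseteq> w" "dim w = Suc (dim z)"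
  using assms by (auto simp: cov_def)

lemma subspace_eqI: "subspace x \<Longrightarrow> subspace y \<Longrightarrow> x \<subseteq> y \<Longrightarrow> dim y \<le> dim x \<Longrightarrow> x = y"
  by (rule subspace_dim_equal)

lemma cov_eqI_above:
  assumes "cov x w" "cov x w'" "w \<subseteq> w'" shows "w = w'"
  by (rule subspace_eqI) (use assms in \<open>auto simp: cov_def\<close>)

lemma cov_eqI_below:
  assumes "cov x w" "cov x' w" "x \<subseteq> x'" shows "x = x'"
  by (rule subspace_eqI) (use assms in \<open>auto simp: cov_def\<close>)

lemma span_of_subspace: "subspace x \<Longrightarrow> span x = x"
  by simp

lemma cov_insert:
  assumes "subspace x" "v \<notin> x"
  shows "cov x (span (insert v x))"
proof -
  have "x \<subseteq> span (insert v x)" using span_superset by blast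
  then show ?thesis using assms by (simp add: cov_def dim_insert span_of_subspace)
qed

lemma cov_eq_span_insert:
  assumes "cov x w" "v \<in> w" "v \<notin> x"
  shows "w = span (insert v x)"
proof -
  have "span (insert v x) \<subseteq> w"
    using assms by (intro span_minimal) (auto dest: covD)
  moreover have "cov x (span (insert v x))"
    using assms cov_insert covD(1) by blast
  ultimately show ?thesis
    using cov_eqI_above assms(1) by blast
qed

text \<open>The sets \<open>w - x\<close>, for the covers \<open>w\<close> of \<open>x\<close>
  inside \<open>y\<close>, partition \<open>y - x\<close>, since a vector outside \<open>x\<close>
  lies in exactly one cover of \<open>x\<close>. All these blocks have the same size.\<close>

lemma card_covers_within:
  assumes x: "subspace x" and y: "subspace y" and xy: "x \<subseteq> y"
  shows "card {w. cov x w \<and> w \<subseteq> y} = qnum CARD('k) (dim y - dim x)"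
proof -
  let ?q = "CARD('k)" and ?C = "{w. cov x w \<and> w \<subseteq> y}"
  obtain d where d: "dim y = dim x + d"
    using dim_subset[OF xy] le_Suc_ex by blast
  have "y - x = (\<Union>w\<in>?C. w - x)"
  proof safe
    fix v assume v: "v \<in> y" "v \<notin> x"
    have "cov x (span (insert v x))" using x v cov_insert by blast
    moreover have "span (insert v x) \<subseteq> y" using v xy y by (intro span_minimal) auto
    ultimately show "v \<in> (\<Union>w\<in>?C. w - x)" using v by (auto intro: span_base)
  qed auto
  moreover have "card (\<Union>w\<in>?C. w - x) = (\<Sum>w\<in>?C. card (w - x))"
  proof (intro card_UN_disjoint ballI impI)
    fix w w' assume "w \<in> ?C" "w' \<in> ?C" "w \<noteq> w'"
    then show "(w - x) \<inter> (w' - x) = {}" using cov_eq_span_insert by blast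
  qed simp_all
  ultimately have "card (y - x) = (\<Sum>w\<in>?C. card (w - x))" by simp
  also have "\<dots> = card ?C * (?q ^ Suc (dim x) - ?q ^ dim x)"
  proof -
    have "card (w - x) = ?q ^ Suc (dim x) - ?q ^ dim x" if "w \<in> ?C" for w
      using that by (auto simp: card_Diff_subset card_subspace cov_def)
    then show ?thesis by simp
  qed
  finally have "?q ^ (dim x + d) - ?q ^ dim x = card ?C * (?q ^ Suc (dim x) - ?q ^ dim x)"
    using xy by (simp add: card_Diff_subset card_subspace x y d)
  then have "?q ^ dim x * (?q ^ d - 1) = ?q ^ dim x * (card ?C * (?q - 1))"
    by (simp add: power_add algebra_simps)
  moreover have "?q ^ d - 1 = qnum CARD('k) d * (?q - 1)"
    using power_eq_qnum[of ?q d] q_ge_2 by simp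
  ultimately show ?thesis using q_ge_2 d by simp
qed

lemma card_covers:
  assumes "subspace x"
  shows "card {w. cov x w} = qnum CARD('k) (n - dim x)"
  using card_covers_within[OF assms subspace_UNIV] by simp

lemma card_cocovers_over:
  assumes "subspace y" "subspace x" "y \<subseteq> x"
  shows "card {z. cov z x \<and> y \<subseteq> z} = qnum CARD('k) (dim x - dim y)"
  using assms
  \<comment> \<open>double counting of the pairs of a hyperplane of \<open>x\<close> and a cover of \<open>y\<close> inside it\<close>
proof (induction "dim x - dim y" arbitrary: y)
  case 0
  then have "dim x = dim y" using dim_subset[OF 0(4)] by linarith
  have "\<not> (cov z x \<and> y \<subseteq> z)" for z
    using dim_subset[of y z] covD(4)[of z x] \<open>dim x = dim y\<close> by auto
  then have "{z. cov z x \<and> y \<subseteq> z} = {}" by simp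
  then show ?case using 0 by simp
next
  case (Suc d)
  show ?case
  \<comment> \<open>The double count ends by cancelling \<open>qnum CARD('k) d\<close>, which is 0
    for \<open>d = 0\<close>; there the only hyperplane is \<open>y\<close> itself.\<close>
  proof (cases "d = 0")
    case True
    with Suc have *: "dim x = Suc (dim y)" by simp
    then have "cov y x" using Suc.prems by (simp add: cov_def)
    then have "{z. cov z x \<and> y \<subseteq> z} = {y}"
      using cov_eqI_below by blast
    then show ?thesis using * by simp
  next
    case False
    let ?H = "{z. cov z x \<and> y \<subseteq> z}" and ?K = "{w. cov y w \<and> w \<subseteq> x}"
    have "(\<Sum>z\<in>?H. card {w\<in>?K. w \<subseteq> z}) = (\<Sum>w\<in>?K. card {z\<in>?H. w \<subseteq> z})"
      by (rule sum_multicount_gen) auto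
    moreover have "(\<Sum>z\<in>?H. card {w\<in>?K. w \<subseteq> z}) = (\<Sum>z\<in>?H. qnum CARD('k) d)"
    proof (rule sum.cong)
      fix z assume z: "z \<in> ?H"
      then have "{w\<in>?K. w \<subseteq> z} = {w. cov y w \<and> w \<subseteq> z}" by (auto dest: covD)
      also have "card \<dots> = qnum CARD('k) (dim z - dim y)"
        using z Suc.prems by (intro card_covers_within) (auto dest: covD)
      also have "dim z - dim y = d"
        using z Suc(2) by (auto dest: covD(4))
      finally show "card {w\<in>?K. w \<subseteq> z} = qnum CARD('k) d" .
    qed simp
    moreover have "(\<Sum>w\<in>?K. card {z\<in>?H. w \<subseteq> z}) = (\<Sum>w\<in>?K. qnum CARD('k) d)"
    proof (rule sum.cong)
      fix w assume w: "w \<in> ?K"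
      then have "{z\<in>?H. w \<subseteq> z} = {z. cov z x \<and> w \<subseteq> z}" by (auto dest: covD)
      also have "d = dim x - dim w" using w Suc(2) by (auto dest: covD(4))
      then have "card {z. cov z x \<and> w \<subseteq> z} = qnum CARD('k) (dim x - dim w)"
        using w Suc.prems Suc.hyps(1) by (auto dest: covD)
      finally show "card {z\<in>?H. w \<subseteq> z} = qnum CARD('k) d" using \<open>d = dim x - dim w\<close> by simp
    qed simp
    ultimately have "card ?H * qnum CARD('k) d = card ?K * qnum CARD('k) d" by simp
    moreover have "qnum CARD('k) d > 0" using False by (cases d) (auto simp: qnum_Suc)
    ultimately show ?thesis
      using card_covers_within[of y x] Suc.prems by simp
  qed
qed

lemma card_cocovers:
  assumes "subspace x"
  shows "card {z. cov z x} = qnum CARD('k) (dim x)"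
proof -
  have "cov z x \<Longrightarrow> {0} \<subseteq> z" for z using subspace_0 covD by blast
  then have "{z. cov z x} = {z. cov z x \<and> {0} \<subseteq> z}" by auto
  also have "card \<dots> = qnum CARD('k) (dim x - dim {0})"
    using assms subspace_0 by (intro card_cocovers_over) auto
  finally show ?thesis by simp
qed

section \<open>Adjacency, common hyperplanes and common covers\<close>

lemma Gr_iff: "x \<in> Gr scale r \<longleftrightarrow> subspace x \<and> dim x = r"
  by (simp add: Gr_def)

lemma dim_Int_plus_span_Un:
  assumes "subspace x" "subspace y"
  shows "dim (x \<inter> y) + dim (span (x \<union> y)) = dim x + dim y"
proof -
  have "span (x \<union> y) = {a + b |a b. a \<in> x \<and> b \<in> y}"
    using assms by (simp add: span_Un span_of_subspace)
  then show ?thesis using dim_sums_Int[OF assms] by simp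
qed

lemma gdist_eq_1_iff:
  assumes "x \<in> Gr scale r" "y \<in> Gr scale r"
  shows "gdist scale x y = 1 \<longleftrightarrow> x \<noteq> y \<and> cov (x \<inter> y) x \<and> cov (x \<inter> y) y"
  using assms by (auto simp: Gr_iff gdist_def cov_def subspace_inter)

text \<open>A common hyperplane lies in \<open>x \<inter> y\<close>, which is a proper subspace of
  \<open>x\<close> and so cannot have larger dimension than \<open>z\<close>.\<close>

lemma cov_Int_unique:
  assumes "cov z x" "cov z y" "x \<noteq> y"
  shows "z = x \<inter> y"
proof (rule subspace_eqI)
  have "\<not> x \<subseteq> y" using assms cov_eqI_above by blast
  then have "x \<inter> y \<subset> x" by auto
  then have "dim (x \<inter> y) < dim x"
    using assms by (intro dim_psubset) (simp add: span_of_subspace subspace_inter covD)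
  then show "dim (x \<inter> y) \<le> dim z" using assms covD by fastforce
qed (use assms subspace_inter in \<open>auto dest: covD\<close>)

text \<open>Dually, a common cover is the join; the dimension formula then shows that the meet is a
  common hyperplane, so that \<open>x\<close> and \<open>y\<close> are adjacent.\<close>

lemma cov_join_unique:
  assumes "cov x w" "cov y w" "x \<noteq> y"
  shows "w = span (x \<union> y)" and "cov (x \<inter> y) x" and "cov (x \<inter> y) y"
proof -
  have le: "span (x \<union> y) \<subseteq> w" using assms by (intro span_minimal) (auto dest: covD)
  have "\<not> y \<subseteq> x" using assms cov_eqI_below by blast
  then have "x \<subset> span (x \<union> y)" using span_superset[of "x \<union> y"] by auto
  then have "dim x < dim (span (x \<union> y))"
    using assms by (intro dim_psubset) (simp only: span_span, simp add: span_of_subspace covD)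
  then have *: "dim w \<le> dim (span (x \<union> y))" using assms covD(4) by simp
  then show w: "w = span (x \<union> y)"
    using subspace_eqI[OF _ _ le] assms covD by auto
  have "dim (x \<inter> y) + dim w = dim x + dim y"
    using dim_Int_plus_span_Un[of x y] assms w by (auto dest: covD)
  then show "cov (x \<inter> y) x" "cov (x \<inter> y) y"
    using assms by (auto simp: cov_def subspace_inter)
qed

lemma adjacent_imp_cov_join:
  assumes "cov z x" "cov z y" "x \<noteq> y"
  shows "cov x (span (x \<union> y))" "cov y (span (x \<union> y))"
proof -
  have "dim z + dim (span (x \<union> y)) = dim x + dim y"
    using dim_Int_plus_span_Un[of x y] assms cov_Int_unique by (metis covD(2))
  then show "cov x (span (x \<union> y))" "cov y (span (x \<union> y))"
    using assms by (auto simp: cov_def intro: span_base)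
qed

text \<open>Each neighbour \<open>y\<close> of \<open>x\<close> is reached through exactly one
  common hyperplane, namely \<open>x \<inter> y\<close>, and the pairs with \<open>y = x\<close>
  contribute 0.\<close>

lemma laplacian_via_meet:
  assumes x: "x \<in> Gr scale r"
  shows "laplacian scale r h x = (\<Sum>z | cov z x. \<Sum>y | cov z y. h y - h x)"
proof -
  let ?S = "Sigma {z. cov z x} (\<lambda>z. {y. cov z y})"
  let ?A = "{y \<in> Gr scale r. gdist scale x y = 1}"
  have "(\<Sum>z | cov z x. \<Sum>y | cov z y. h y - h x) = (\<Sum>(z, y)\<in>?S. h y - h x)"
    by (rule sum.Sigma) auto
  also have "\<dots> = (\<Sum>(z, y)\<in>{(z, y)\<in>?S. y \<noteq> x}. h y - h x)"
    by (rule sum.mono_neutral_right) auto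
  also have "\<dots> = (\<Sum>y\<in>?A. h y - h x)"
  proof (rule sum.reindex_bij_witness[of _ "\<lambda>y. (x \<inter> y, y)" snd])
    fix a assume a: "a \<in> {(z, y)\<in>?S. y \<noteq> x}"
    then obtain z y where [simp]: "a = (z, y)" and zy: "cov z x" "cov z y" "y \<noteq> x" by auto
    with cov_Int_unique have z: "z = x \<inter> y" by metis
    then show "(x \<inter> snd a, snd a) = a" by simp
    have y: "y \<in> Gr scale r" using x zy by (simp add: Gr_iff cov_def)
    then show "snd a \<in> ?A" using gdist_eq_1_iff[OF x y] zy z by simp
  next
    fix y assume "y \<in> ?A"
    then show "(x \<inter> y, y) \<in> {(z, y)\<in>?S. y \<noteq> x}"
      using gdist_eq_1_iff[OF x] by auto
  qed auto
  finally show ?thesis using x by (simp add: laplacian_def)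
qed

text \<open>As before, but through the unique common cover \<open>span (x \<union> y)\<close> of two
  neighbours.\<close>

lemma laplacian_via_join:
  assumes x: "x \<in> Gr scale r"
  shows "laplacian scale r h x = (\<Sum>w | cov x w. \<Sum>y | cov y w. h y - h x)"
proof -
  let ?S = "Sigma {w. cov x w} (\<lambda>w. {y. cov y w})"
  let ?A = "{y \<in> Gr scale r. gdist scale x y = 1}"
  have "(\<Sum>w | cov x w. \<Sum>y | cov y w. h y - h x) = (\<Sum>(w, y)\<in>?S. h y - h x)"
    by (rule sum.Sigma) auto
  also have "\<dots> = (\<Sum>(w, y)\<in>{(w, y)\<in>?S. y \<noteq> x}. h y - h x)"
    by (rule sum.mono_neutral_right) auto
  also have "\<dots> = (\<Sum>y\<in>?A. h y - h x)"
  proof (rule sum.reindex_bij_witness[of _ "\<lambda>y. (span (x \<union> y), y)" snd])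
    fix a assume a: "a \<in> {(w, y)\<in>?S. y \<noteq> x}"
    then obtain w y where [simp]: "a = (w, y)" and wy: "cov x w" "cov y w" "x \<noteq> y" by auto
    note w = cov_join_unique[OF wy]
    show "(span (x \<union> snd a), snd a) = a" using w by simp
    have y: "y \<in> Gr scale r" using x wy by (simp add: Gr_iff cov_def)
    then show "snd a \<in> ?A" using gdist_eq_1_iff[OF x y] w wy by simp
  next
    fix y assume "y \<in> ?A"
    then have "cov (x \<inter> y) x" "cov (x \<inter> y) y" "x \<noteq> y"
      using gdist_eq_1_iff[OF x] by auto
    then show "(span (x \<union> y), y) \<in> {(w, y)\<in>?S. y \<noteq> x}"
      using adjacent_imp_cov_join[of "x \<inter> y" x y] by auto
  qed auto
  finally show ?thesis using x by (simp add: laplacian_def)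
qed

section \<open>Distances to a fixed subspace and the Laplacian of a radial function\<close>

lemma subset_spanI: "A \<subseteq> B \<Longrightarrow> A \<subseteq> span B"
  using span_superset[of B] by (rule order_trans[rotated])

text \<open>By the dimension formula, passing from \<open>z\<close> to \<open>y\<close> enlarges
  exactly one of the meet and the join with \<open>x\<close>, and the join stays the same exactly
  when it contains \<open>y\<close>. This form suits counting the covers of a fixed
  \<open>z\<close>.\<close>

lemma dim_Int_of_cov:
  assumes "cov z y" "subspace x"
  shows "dim (y \<inter> x) = (if y \<subseteq> span (z \<union> x) then Suc (dim (z \<inter> x)) else dim (z \<inter> x))"
proof -
  have z: "dim (z \<inter> x) + dim (span (z \<union> x)) = dim z + dim x"
    and y: "dim (y \<inter> x) + dim (span (y \<union> x)) = Suc (dim z) + dim x"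
    using dim_Int_plus_span_Un assms by (simp_all add: cov_def)
  have zy: "z \<subseteq> y" using assms by (simp add: cov_def)
  show ?thesis
  proof (cases "y \<subseteq> span (z \<union> x)")
    case True
    have "span (y \<union> x) = span (z \<union> x)"
    proof
      have "x \<subseteq> span (z \<union> x)" using span_superset by blast
      then show "span (y \<union> x) \<subseteq> span (z \<union> x)"
        using True by (intro span_minimal) auto
      show "span (z \<union> x) \<subseteq> span (y \<union> x)"
        using zy by (intro span_mono Un_mono order_refl)
    qed
    then show ?thesis using True y z by simp
  next
    case False
    then obtain v where v: "v \<in> y" "v \<notin> span (z \<union> x)" by blast
    then have "v \<notin> z" using span_superset by blast
    then have eq: "y = span (insert v z)" using cov_eq_span_insert assms v by blast
    have "span (y \<union> x) = span (insert v (z \<union> x))"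
    proof
      have "y \<subseteq> span (insert v (z \<union> x))" unfolding eq by (intro span_mono) auto
      moreover have "x \<subseteq> span (insert v (z \<union> x))" by (intro subset_spanI) auto
      ultimately show "span (y \<union> x) \<subseteq> span (insert v (z \<union> x))"
        by (intro span_minimal) auto
      show "span (insert v (z \<union> x)) \<subseteq> span (y \<union> x)"
        using zy v(1) by (intro span_mono insert_subsetI Un_mono) auto
    qed
    then have "dim (span (y \<union> x)) = Suc (dim (span (z \<union> x)))"
      using v by (simp add: dim_insert)
    then show ?thesis using False y z by simp
  qed
qed

text \<open>The same alternative, in the form suited to counting the hyperplanes \<open>z\<close> of
  a fixed \<open>y\<close>.\<close>

lemma dim_Int_of_cocov:
  assumes "cov z y" "subspace x"
  shows "dim (y \<inter> x) = (if y \<inter> x \<subseteq> z then dim (z \<inter> x) else Suc (dim (z \<inter> x)))"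
proof (cases "y \<inter> x \<subseteq> z")
  case True
  then have "y \<inter> x = z \<inter> x" using assms by (auto simp: cov_def)
  with True show ?thesis by simp
next
  case False
  then obtain v where v: "v \<in> y" "v \<in> x" "v \<notin> z" by blast
  have eq: "y = span (insert v z)" using cov_eq_span_insert assms v by blast
  have "insert v z \<subseteq> span (z \<union> x)" using v span_superset by blast
  then have "y \<subseteq> span (z \<union> x)" unfolding eq by (intro span_minimal) auto
  then show ?thesis using dim_Int_of_cov[OF assms] False by simp
qed

lemma gdist_cases:
  assumes "y \<in> Gr scale r2" "x \<in> Gr scale r1"
  obtains d where "dim (y \<inter> x) = d" "gdist scale y x = r2 - d" "d \<le> r2" "d \<le> r1" "r1 + r2 \<le> n + d"
proof
  show "dim (y \<inter> x) = dim (y \<inter> x)" ..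
  show "gdist scale y x = r2 - dim (y \<inter> x)" using assms by (simp add: gdist_def Gr_iff)
  show "dim (y \<inter> x) \<le> r2" "dim (y \<inter> x) \<le> r1"
    using assms dim_subset[of "y \<inter> x"] by (auto simp: Gr_iff)
  have "dim (span (y \<union> x)) \<le> n" using dim_subset[OF subset_UNIV] by simp
  then show "r1 + r2 \<le> n + dim (y \<inter> x)"
    using dim_Int_plus_span_Un[of y x] assms by (simp add: Gr_iff)
qed

lemma gdist_in_II:
  assumes "y \<in> Gr scale r2" "x \<in> Gr scale r1"
  shows "gdist scale y x \<in> II n r1 r2"
  by (rule gdist_cases[OF assms]) (auto simp: II_def)

text \<open>Coordinate subspaces realize every admissible distance: \<open>C\<close> is a basis of
  the join, \<open>D\<close> one of \<open>x\<close>, and \<open>F\<close> supplies the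
  \<open>r2 - t\<close> basis vectors of the meet.\<close>

lemma ex_gdist:
  assumes "t \<in> II n r1 r2"
  obtains y x where "y \<in> Gr scale r2" "x \<in> Gr scale r1" "gdist scale y x = t"
proof -
  have t: "r2 \<le> r1 + t" "t \<le> r2" "r1 + t \<le> n" using assms by (auto simp: II_def)
  obtain C where C: "C \<subseteq> Basis" "card C = r1 + t"
    using obtain_subset_with_card_n[OF t(3)] by metis
  obtain D where D: "D \<subseteq> C" "card D = r1"
    using obtain_subset_with_card_n[of r1 C] C by auto
  obtain F where F: "F \<subseteq> D" "card F = r2 - t"
    using obtain_subset_with_card_n[of "r2 - t" D] D t by (metis le_diff_conv)
  let ?x = "span D" and ?y = "span ((C - D) \<union> F)"
  have dim_span_sub: "dim (span A) = card A" if "A \<subseteq> C" for A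
  proof -
    have "independent A" using independent_mono[OF independent_Basis] that C by blast
    then show ?thesis by (rule dim_span_eq_card_independent)
  qed
  have "card ((C - D) \<union> F) = card (C - D) + card F"
    using F by (intro card_Un_disjoint) auto
  also have "\<dots> = r2" using C D F t by (simp add: card_Diff_subset)
  finally have y: "dim ?y = r2" using dim_span_sub[of "(C - D) \<union> F"] D F by auto
  have x: "dim ?x = r1" using dim_span_sub D by auto
  have "span (?y \<union> ?x) = span C"
  proof
    have "?y \<subseteq> span C" "?x \<subseteq> span C" using D F by (auto intro!: span_mono)
    then show "span (?y \<union> ?x) \<subseteq> span C" by (intro span_minimal) auto
    have "C - D \<subseteq> ?y" "D \<subseteq> ?x" by (auto intro: span_base)
    then have "C \<subseteq> ?y \<union> ?x" by auto
    then show "span C \<subseteq> span (?y \<union> ?x)" by (rule span_mono)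
  qed
  then have "dim (span (?y \<union> ?x)) = r1 + t" using dim_span_sub C by auto
  then have "dim (?y \<inter> ?x) + t = r2"
    using dim_Int_plus_span_Un[of ?y ?x] x y by simp
  then have "gdist scale ?y ?x = t" using y by (simp add: gdist_def)
  moreover have "?y \<in> Gr scale r2" "?x \<in> Gr scale r1" using x y by (simp_all add: Gr_iff)
  ultimately show ?thesis using that by blast
qed

text \<open>A step from \<open>y\<close> goes down to a hyperplane \<open>z\<close> and up to a
  cover \<open>w\<close> of \<open>z\<close>. The distance to \<open>x\<close> drops if
  \<open>z\<close> contains \<open>y \<inter> x\<close> and \<open>w\<close> lies in the join of
  \<open>z\<close> and \<open>x\<close>; it grows if both fail; otherwise it is unchanged. At
  \<open>r2 = d\<close> the truncated argument of \<kappa> is harmless, its coefficient being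
  0.\<close>

lemma laplacian_radial:
  assumes y: "y \<in> Gr scale r2" and x: "x \<in> Gr scale r1" and d: "dim (y \<inter> x) = d"
  defines "Q \<equiv> \<lambda>k. of_nat (qnum CARD('k) k) :: complex"
  shows "laplacian scale r2 (\<lambda>w. \<kappa> (gdist scale w x)) y =
      Q (r2 - d) * Q (r1 - d) * (\<kappa> (r2 - d - 1) - \<kappa> (r2 - d)) +
      (Q r2 - Q (r2 - d)) * (Q (Suc (n - r2)) - Q (Suc (r1 - d))) * (\<kappa> (Suc (r2 - d)) - \<kappa> (r2 - d))"
    (is "_ = ?R")
proof -
  let ?t = "r2 - d"
  have sub: "subspace x" "subspace y" "dim x = r1" "dim y = r2" using x y by (auto simp: Gr_iff)
  have d_le: "d \<le> r1" "d \<le> r2" using dim_subset[of "y \<inter> x"] d sub by auto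
  have hy: "\<kappa> (gdist scale y x) = \<kappa> ?t" using d sub by (simp add: gdist_def)
  have inner: "(\<Sum>w | cov z w. \<kappa> (gdist scale w x) - \<kappa> ?t) =
      Q (r1 - dim (z \<inter> x)) * (\<kappa> (r2 - dim (z \<inter> x) - 1) - \<kappa> ?t) +
      (Q (Suc (n - r2)) - Q (r1 - dim (z \<inter> x))) * (\<kappa> (r2 - dim (z \<inter> x)) - \<kappa> ?t)"
    if z: "cov z y" for z
  proof -
    have *: "{w\<in>{w. cov z w}. w \<subseteq> span (z \<union> x)} = {w. cov z w \<and> w \<subseteq> span (z \<union> x)}"
      by auto
    have "dim (z \<inter> x) + dim (span (z \<union> x)) = dim z + r1"
      using dim_Int_plus_span_Un[of z x] z sub by (simp add: cov_def)
    then have e: "dim (span (z \<union> x)) - dim z = r1 - dim (z \<inter> x)"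
      using dim_subset[of "z \<inter> x" x] sub by simp
    have "z \<subseteq> span (z \<union> x)" using span_superset by blast
    then have c1: "card {w. cov z w \<and> w \<subseteq> span (z \<union> x)} = qnum CARD('k) (r1 - dim (z \<inter> x))"
      using card_covers_within[of z "span (z \<union> x)"] z e by (simp add: cov_def)
    have r2: "r2 = Suc (dim z)" using z sub by (simp add: cov_def)
    have "r2 \<le> n" using dim_subset[OF subset_UNIV, of y] sub by simp
    then have c2: "card {w. cov z w} = qnum CARD('k) (Suc (n - r2))"
      using card_covers[of z] z r2 Suc_diff_le by (simp add: cov_def Suc_diff_Suc)
    have vals: "\<kappa> (gdist scale w x) - \<kappa> ?t = (if w \<subseteq> span (z \<union> x)
        then \<kappa> (r2 - dim (z \<inter> x) - 1) - \<kappa> ?t else \<kappa> (r2 - dim (z \<inter> x)) - \<kappa> ?t)"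
      if "w \<in> {w. cov z w}" for w
    proof -
      have w: "cov z w" using that by simp
      then have "dim w = r2" using r2 by (simp add: cov_def)
      then show ?thesis using dim_Int_of_cov[OF w sub(1)] by (simp add: gdist_def)
    qed
    show ?thesis
      using sum_if_two_values[of "{w. cov z w}" "\<lambda>w. \<kappa> (gdist scale w x) - \<kappa> ?t", OF finite_set_set vals] unfolding * c1 c2 Q_def .
  qed
  have outer: "(\<Sum>w | cov z w. \<kappa> (gdist scale w x) - \<kappa> ?t) =
      (if y \<inter> x \<subseteq> z then Q (r1 - d) * (\<kappa> (?t - 1) - \<kappa> ?t)
       else (Q (Suc (n - r2)) - Q (Suc (r1 - d))) * (\<kappa> (Suc ?t) - \<kappa> ?t))"
    if "z \<in> {z. cov z y}" for z
  proof -
    have z: "cov z y" using that by simp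
    \<comment> \<open>A hyperplane that does not contain \<open>y \<inter> x\<close> exists only for
      positive \<open>d\<close>, so \<open>d - 1\<close> is never truncated where it is
      needed.\<close>
    have "Suc (r1 - d) = r1 - (d - 1)" "Suc (r2 - d) = r2 - (d - 1)" if "d > 0"
      using that d_le by auto
    then show ?thesis
      using inner[OF z] dim_Int_of_cocov[OF z sub(1)] d by (cases "y \<inter> x \<subseteq> z") auto
  qed
  note sum_if_two_values[of "{z. cov z y}" "\<lambda>z. \<Sum>w | cov z w. \<kappa> (gdist scale w x) - \<kappa> ?t", OF finite_set_set outer]
  moreover have "{z\<in>{z. cov z y}. y \<inter> x \<subseteq> z} = {z. cov z y \<and> y \<inter> x \<subseteq> z}" by auto
  moreover have "card {z. cov z y \<and> y \<inter> x \<subseteq> z} = qnum CARD('k) ?t"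
    using card_cocovers_over[of "y \<inter> x" y] sub d by (simp add: subspace_inter)
  moreover have "card {z. cov z y} = qnum CARD('k) r2"
    using card_cocovers sub by simp
  ultimately show ?thesis
    unfolding laplacian_via_meet[OF y] hy by (simp add: Q_def)
qed

end

section \<open>The up and down operators\<close>

lemma VV_0: "0 \<in> VV smul r"
  and VV_add: "\<phi> \<in> VV smul r \<Longrightarrow> \<psi> \<in> VV smul r \<Longrightarrow> \<phi> + \<psi> \<in> VV smul r"
  and VV_diff: "\<phi> \<in> VV smul r \<Longrightarrow> \<psi> \<in> VV smul r \<Longrightarrow> \<phi> - \<psi> \<in> VV smul r"
  and VV_cscale: "\<phi> \<in> VV smul r \<Longrightarrow> cscale c \<phi> \<in> VV smul r"
  by (auto simp: VV_def cscale_def)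

lemma subspace_VV: "cfun.subspace (VV smul r)"
  by (auto simp: cfun.subspace_def VV_0 VV_add VV_cscale)

lemma laplacian_add: "laplacian smul r (\<phi> + \<psi>) = laplacian smul r \<phi> + laplacian smul r \<psi>"
  by (simp add: laplacian_def fun_eq_iff sum.distrib[symmetric] algebra_simps)

lemma laplacian_cscale: "laplacian smul r (cscale c \<phi>) = cscale c (laplacian smul r \<phi>)"
  by (simp add: laplacian_def cscale_def fun_eq_iff sum_distrib_left algebra_simps)

context finite_field_space begin

text \<open>No level is mentioned: a function supported on one level is moved to the next one by its
  support alone.\<close>

definition up :: "('v set \<Rightarrow> complex) \<Rightarrow> 'v set \<Rightarrow> complex" where
  "up \<phi> w = (\<Sum>z | cov z w. \<phi> z)"

definition down :: "('v set \<Rightarrow> complex) \<Rightarrow> 'v set \<Rightarrow> complex" where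
  "down \<phi> z = (\<Sum>w | cov z w. \<phi> w)"

lemma up_add: "up (\<phi> + \<psi>) = up \<phi> + up \<psi>"
  and up_cscale: "up (cscale c \<phi>) = cscale c (up \<phi>)"
  and down_add: "down (\<phi> + \<psi>) = down \<phi> + down \<psi>"
  and down_diff: "down (\<phi> - \<psi>) = down \<phi> - down \<psi>"
  and down_cscale: "down (cscale c \<phi>) = cscale c (down \<phi>)"
  by (simp_all add: up_def down_def cscale_def fun_eq_iff sum.distrib sum_subtractf sum_distrib_left)

lemma up_zero: "up 0 = 0"
  by (simp add: up_def fun_eq_iff)

lemma up_VV: "\<phi> \<in> VV scale r \<Longrightarrow> up \<phi> \<in> VV scale (Suc r)"
  by (auto simp: VV_def up_def Gr_iff cov_def intro!: sum.neutral)

lemma down_VV: "\<phi> \<in> VV scale (Suc r) \<Longrightarrow> down \<phi> \<in> VV scale r"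
  by (auto simp: VV_def down_def Gr_iff cov_def intro!: sum.neutral)

text \<open>A subspace of dimension 0 covers nothing. This takes the place of \<open>down_VV\<close>
  at the bottom, where no lower level exists.\<close>

lemma down_VV_0: "\<phi> \<in> VV scale 0 \<Longrightarrow> down \<phi> = 0"
  unfolding fun_eq_iff down_def
  by (intro allI, subst sum.neutral) (auto simp: VV_def Gr_def cov_def simp del: dim_eq_0)

lemma laplacian_VV: "laplacian scale r \<phi> \<in> VV scale r"
  by (simp add: VV_def laplacian_def)

text \<open>The scalar counts how often \<open>\<phi> x\<close> is subtracted in
  \<open>laplacian_via_join\<close>: \<open>x\<close> has \<open>[n - r]\<close> covers, each with
  \<open>[r + 1]\<close> hyperplanes.\<close>

lemma down_up:
  assumes "\<phi> \<in> VV scale r"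
  shows "down (up \<phi>) = laplacian scale r \<phi> +
    cscale (of_nat (qnum CARD('k) (n - r) * qnum CARD('k) (Suc r))) \<phi>"
proof
  fix x
  show "down (up \<phi>) x = (laplacian scale r \<phi> +
    cscale (of_nat (qnum CARD('k) (n - r) * qnum CARD('k) (Suc r))) \<phi>) x"
  proof (cases "x \<in> Gr scale r")
    case True
    then have x: "subspace x" "dim x = r" by (simp_all add: Gr_iff)
    have "(\<Sum>w | cov x w. \<Sum>y | cov y w. \<phi> y - \<phi> x) =
        (\<Sum>w | cov x w. up \<phi> w - of_nat (qnum CARD('k) (Suc r)) * \<phi> x)"
    proof (intro sum.cong refl)
      fix w assume "w \<in> {w. cov x w}"
      then have "card {y. cov y w} = qnum CARD('k) (Suc r)"
        using x card_cocovers[of w] by (simp add: cov_def)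
      then show "(\<Sum>y | cov y w. \<phi> y - \<phi> x) = up \<phi> w - of_nat (qnum CARD('k) (Suc r)) * \<phi> x"
        by (simp add: sum_subtractf up_def)
    qed
    then show ?thesis
      unfolding laplacian_via_join[OF True] plus_fun_apply
      by (simp add: sum_subtractf down_def cscale_def card_covers x)
  qed (use assms down_VV[OF up_VV[OF assms]] in \<open>simp add: VV_def cscale_def laplacian_def\<close>)
qed

text \<open>In \<open>laplacian_via_meet\<close>, \<open>x\<close> has \<open>[r]\<close>
  hyperplanes, each with \<open>[n - r + 1]\<close> covers.\<close>

lemma up_down:
  assumes "\<phi> \<in> VV scale r" "r \<le> n"
  shows "up (down \<phi>) = laplacian scale r \<phi> +
    cscale (of_nat (qnum CARD('k) r * qnum CARD('k) (Suc (n - r)))) \<phi>"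
proof
  fix x
  show "up (down \<phi>) x = (laplacian scale r \<phi> +
    cscale (of_nat (qnum CARD('k) r * qnum CARD('k) (Suc (n - r)))) \<phi>) x"
  proof (cases "x \<in> Gr scale r")
    case True
    then have x: "subspace x" "dim x = r" by (simp_all add: Gr_iff)
    have "(\<Sum>z | cov z x. \<Sum>y | cov z y. \<phi> y - \<phi> x) =
        (\<Sum>z | cov z x. down \<phi> z - of_nat (qnum CARD('k) (Suc (n - r))) * \<phi> x)"
    proof (intro sum.cong refl)
      fix z assume "z \<in> {z. cov z x}"
      then have "card {y. cov z y} = qnum CARD('k) (Suc (n - r))"
        using x assms(2) card_covers[of z] by (auto simp: cov_def Suc_diff_Suc)
      then show "(\<Sum>y | cov z y. \<phi> y - \<phi> x) = down \<phi> z - of_nat (qnum CARD('k) (Suc (n - r))) * \<phi> x"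
        by (simp add: sum_subtractf down_def)
    qed
    then show ?thesis
      unfolding laplacian_via_meet[OF True] plus_fun_apply
      by (simp add: sum_subtractf up_def cscale_def card_cocovers x)
  next
    case False
    then have "up (down \<phi>) x = 0"
    proof (cases r)
      case 0
      then show ?thesis using assms down_VV_0 up_zero by simp
    next
      case (Suc r')
      then show ?thesis using assms up_VV[OF down_VV] False by (simp add: VV_def)
    qed
    then show ?thesis using assms False by (simp add: VV_def cscale_def laplacian_def)
  qed
qed

text \<open>Computing \<open>up (down (up \<phi>))\<close> by \<open>up_down\<close> and by
  \<open>down_up\<close> produces the same scalar \<open>[n - r] [r + 1]\<close>, which
  cancels.\<close>

lemma laplacian_up:
  assumes "\<phi> \<in> VV scale r" "r < n"
  shows "laplacian scale (Suc r) (up \<phi>) = up (laplacian scale r \<phi>)"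
proof -
  have "Suc (n - Suc r) = n - r" using assms by simp
  then have "up (down (up \<phi>)) = laplacian scale (Suc r) (up \<phi>) +
      cscale (of_nat (qnum CARD('k) (n - r) * qnum CARD('k) (Suc r))) (up \<phi>)"
    using up_down[OF up_VV[OF assms(1)]] assms by (simp add: mult.commute)
  moreover have "up (down (up \<phi>)) = up (laplacian scale r \<phi>) +
      cscale (of_nat (qnum CARD('k) (n - r) * qnum CARD('k) (Suc r))) (up \<phi>)"
    unfolding down_up[OF assms(1)] by (simp only: up_add up_cscale)
  ultimately show ?thesis by simp
qed

lemma laplacian_down:
  assumes "\<phi> \<in> VV scale (Suc r)" "r < n"
  shows "laplacian scale r (down \<phi>) = down (laplacian scale (Suc r) \<phi>)"
proof -
  have eq: "Suc (n - Suc r) = n - r" using assms by simp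
  have "down (up (down \<phi>)) = laplacian scale r (down \<phi>) +
      cscale (of_nat (qnum CARD('k) (n - r) * qnum CARD('k) (Suc r))) (down \<phi>)"
    using down_up[OF down_VV[OF assms(1)]] .
  moreover have "down (up (down \<phi>)) = down (laplacian scale (Suc r) \<phi>) +
      cscale (of_nat (qnum CARD('k) (n - r) * qnum CARD('k) (Suc r))) (down \<phi>)"
    using up_down[OF assms(1)] assms(2) eq by (simp only: Suc_leI down_add down_cscale mult.commute)
  ultimately show ?thesis by simp
qed

section \<open>Adjointness and injectivity of the two operators\<close>

lemma VV_inner_UNIV:
  assumes "\<phi> \<in> VV scale r \<or> \<psi> \<in> VV scale r"
  shows "VV_inner scale r \<phi> \<psi> = (\<Sum>x\<in>UNIV. \<phi> x * cnj (\<psi> x))"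
  unfolding VV_inner_def using assms by (intro sum.mono_neutral_left) (auto simp: VV_def)

lemma up_down_adjoint:
  assumes "\<phi> \<in> VV scale r" "\<psi> \<in> VV scale (Suc r)"
  shows "VV_inner scale (Suc r) (up \<phi>) \<psi> = VV_inner scale r \<phi> (down \<psi>)"
proof -
  have "VV_inner scale (Suc r) (up \<phi>) \<psi> = (\<Sum>w\<in>UNIV. \<Sum>z | z \<in> UNIV \<and> cov z w. \<phi> z * cnj (\<psi> w))"
    using assms by (simp add: VV_inner_UNIV up_def sum_distrib_right)
  also have "\<dots> = (\<Sum>z\<in>UNIV. \<Sum>w | w \<in> UNIV \<and> cov z w. \<phi> z * cnj (\<psi> w))"
    by (rule sum.swap_restrict) auto
  also have "\<dots> = VV_inner scale r \<phi> (down \<psi>)"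
    using assms by (simp add: VV_inner_UNIV down_def sum_distrib_left)
  finally show ?thesis .
qed

lemma VV_inner_self:
  "VV_inner scale r \<phi> \<phi> = of_real (\<Sum>x\<in>Gr scale r. (cmod (\<phi> x))\<^sup>2)"
  by (simp only: VV_inner_def of_real_sum complex_norm_square)

lemma VV_inner_add_cscale_right:
  "VV_inner scale r \<phi> (\<psi> + cscale c \<chi>) = VV_inner scale r \<phi> \<psi> + cnj c * VV_inner scale r \<phi> \<chi>"
  by (simp add: VV_inner_def cscale_def sum.distrib sum_distrib_left distrib_left mult_ac)

lemma VV_inner_self_0:
  assumes "\<phi> \<in> VV scale r" "VV_inner scale r \<phi> \<phi> = 0"
  shows "\<phi> = 0"
proof
  fix x
  have "(\<Sum>x\<in>Gr scale r. (cmod (\<phi> x))\<^sup>2) = 0"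
    using assms(2) unfolding VV_inner_self by (simp only: of_real_eq_0_iff)
  then show "\<phi> x = 0 x"
    using assms(1) by (cases "x \<in> Gr scale r") (auto simp: sum_nonneg_eq_0_iff VV_def)
qed

text \<open>With \<open>a = n - r\<close> and \<open>b = r\<close> this is the scalar by which
  \<open>down \<circ> up\<close> exceeds \<open>up \<circ> down\<close> at level \<open>r\<close>.
  It is stated over the reals because its sign decides which operator is injective.\<close>

lemma qnum_mult_diff:
  "of_nat (qnum q a * qnum q (Suc b)) - of_nat (qnum q b * qnum q (Suc a)) =
   (of_nat (qnum q a) - of_nat (qnum q b) :: real)"
  by (simp add: qnum_Suc algebra_simps)

text \<open>The commutation relation of \<open>up\<close> and \<open>down\<close>, paired with
  \<phi>. Keeping \<open>up (down \<phi>)\<close> instead of the norm of \<open>down \<phi>\<close>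
  lets level 0 be included.\<close>

lemma norm_up_down:
  assumes "\<phi> \<in> VV scale r" "r \<le> n"
  shows "VV_inner scale (Suc r) (up \<phi>) (up \<phi>) =
    VV_inner scale r (up (down \<phi>)) \<phi> +
    of_real (of_nat (qnum CARD('k) (n - r)) - of_nat (qnum CARD('k) r)) * VV_inner scale r \<phi> \<phi>"
proof -
  let ?c = "of_real (of_nat (qnum CARD('k) (n - r)) - of_nat (qnum CARD('k) r)) :: complex"
  have "down (up \<phi>) = up (down \<phi>) + cscale ?c \<phi>"
    unfolding down_up[OF assms(1)] up_down[OF assms] qnum_mult_diff[symmetric]
    by (simp add: cscale_def fun_eq_iff algebra_simps)
  then have "VV_inner scale (Suc r) (up \<phi>) (up \<phi>) = VV_inner scale r \<phi> (up (down \<phi>) + cscale ?c \<phi>)"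
    using up_down_adjoint[OF assms(1) up_VV[OF assms(1)]] by simp
  also have "\<dots> = VV_inner scale r \<phi> (up (down \<phi>)) + ?c * VV_inner scale r \<phi> \<phi>"
    unfolding VV_inner_add_cscale_right complex_cnj_complex_of_real ..
  also have "VV_inner scale r \<phi> (up (down \<phi>)) = VV_inner scale r (up (down \<phi>)) \<phi>"
  proof (cases r)
    case 0
    then show ?thesis using assms down_VV_0 up_zero by (simp add: VV_inner_def)
  next
    case (Suc r')
    have "VV_inner scale r \<phi> (up (down \<phi>)) = cnj (VV_inner scale r (up (down \<phi>)) \<phi>)"
      by (simp add: VV_inner_def mult.commute)
    also have "VV_inner scale r (up (down \<phi>)) \<phi> = VV_inner scale r' (down \<phi>) (down \<phi>)"
      using assms Suc up_down_adjoint[OF down_VV] by simp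
    also have "cnj \<dots> = \<dots>" unfolding VV_inner_self by simp
    finally show ?thesis using assms Suc up_down_adjoint[OF down_VV] by simp
  qed
  finally show ?thesis .
qed

text \<open>Below the middle the scalar in \<open>norm_up_down\<close> is positive, and the term
  with \<open>up (down \<phi>)\<close> is nonnegative, so a vanishing left side forces the norm of
  \<phi> to vanish.\<close>

lemma up_inj:
  assumes "\<phi> \<in> VV scale r" "2 * r < n" "up \<phi> = 0"
  shows "\<phi> = 0"
proof (rule VV_inner_self_0[OF assms(1)])
  let ?c = "real (qnum CARD('k) (n - r)) - real (qnum CARD('k) r)"
  have c: "?c > 0"
    using strict_mono_qnum[of "CARD('k)"] assms(2) q_ge_2 by (simp add: strict_mono_less)
  obtain d where d: "VV_inner scale r (up (down \<phi>)) \<phi> = of_real d" "d \<ge> 0"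
  proof (cases r)
    case 0
    then show ?thesis using assms down_VV_0 up_zero that[of 0] by (simp add: VV_inner_def)
  next
    case (Suc r')
    show ?thesis
    proof (rule that)
      show "VV_inner scale r (up (down \<phi>)) \<phi> = of_real (\<Sum>x\<in>Gr scale r'. (cmod (down \<phi> x))\<^sup>2)"
        using assms Suc up_down_adjoint[OF down_VV] VV_inner_self by metis
    qed (intro sum_nonneg, simp)
  qed
  have "(0 :: complex) = of_real (d + ?c * (\<Sum>x\<in>Gr scale r. (cmod (\<phi> x))\<^sup>2))"
  proof -
    have "VV_inner scale (Suc r) (up \<phi>) (up \<phi>) = 0" using assms(3) by (simp add: VV_inner_def)
    then show ?thesis
      using norm_up_down[OF assms(1)] assms(2) d(1) unfolding VV_inner_self[of r \<phi>]
      by (simp only: of_real_add of_real_mult)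
  qed
  then have "d + ?c * (\<Sum>x\<in>Gr scale r. (cmod (\<phi> x))\<^sup>2) = 0"
    by (metis of_real_eq_0_iff)
  moreover have "(\<Sum>x\<in>Gr scale r. (cmod (\<phi> x))\<^sup>2) \<ge> 0" by (intro sum_nonneg) simp
  ultimately show "VV_inner scale r \<phi> \<phi> = 0"
    using d c unfolding VV_inner_self by (smt (verit) mult_pos_pos of_real_0)
qed

text \<open>Above the middle the scalar in \<open>norm_up_down\<close> is negative. If
  \<open>down \<phi>\<close> vanishes, one squared norm is a negative multiple of another, so both
  are 0.\<close>

lemma down_inj:
  assumes "\<phi> \<in> VV scale r" "n < 2 * r" "r \<le> n" "down \<phi> = 0"
  shows "\<phi> = 0"
proof (rule VV_inner_self_0[OF assms(1)])
  let ?c = "real (qnum CARD('k) (n - r)) - real (qnum CARD('k) r)"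
  let ?S = "(\<Sum>x\<in>Gr scale r. (cmod (\<phi> x))\<^sup>2)" and ?T = "(\<Sum>x\<in>Gr scale (Suc r). (cmod (up \<phi> x))\<^sup>2)"
  have c: "?c < 0"
    using strict_mono_qnum[of "CARD('k)"] assms(2,3) q_ge_2 by (simp add: strict_mono_less)
  have "of_real ?T = VV_inner scale r (up (down \<phi>)) \<phi> + of_real ?c * of_real ?S"
    using norm_up_down[OF assms(1,3)] unfolding VV_inner_self .
  also have "VV_inner scale r (up (down \<phi>)) \<phi> = 0"
    using assms(4) by (simp add: up_zero VV_inner_def)
  finally have "of_real ?T = (of_real (?c * ?S) :: complex)"
    by (simp only: add_0 of_real_mult)
  then have "?T = ?c * ?S" by (simp only: of_real_eq_iff)
  moreover have "?S \<ge> 0" "?T \<ge> 0" by (intro sum_nonneg; simp)+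
  ultimately show "VV_inner scale r \<phi> \<phi> = 0"
    using c unfolding VV_inner_self by (smt (verit) mult_neg_pos of_real_0)
qed

section \<open>The action of the general linear group\<close>

lemma GL_inv:
  assumes "g \<in> GL scale" shows "inv g \<in> GL scale"
proof -
  have g: "Vector_Spaces.linear scale scale g" "bij g" using assms by (auto simp: GL_def)
  then have "Vector_Spaces.linear scale scale (inv g)"
    by (intro inj_linear_imp_inv_linear) (auto simp: bij_def)
  then show ?thesis using g by (simp add: GL_def bij_imp_bij_inv)
qed

lemma GL_image:
  assumes "g \<in> GL scale" "subspace x"
  shows "subspace (g ` x)" "dim (g ` x) = dim x"
proof -
  have g: "Vector_Spaces.linear scale scale g" "bij g" using assms by (auto simp: GL_def)
  interpret g: Vector_Spaces.linear scale scale g by fact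
  interpret p: finite_dimensional_vector_space_pair scale Basis scale Basis ..
  show "subspace (g ` x)" using assms(2) by (rule g.subspace_image)
  show "dim (g ` x) = dim x"
    by (rule p.dim_image_eq[OF g(1)]) (meson bij_is_inj g(2) inj_on_subset subset_UNIV)
qed

lemma GL_inv_image: "g \<in> GL scale \<Longrightarrow> inv g ` g ` x = x" "g \<in> GL scale \<Longrightarrow> g ` inv g ` x = x"
  by (auto simp: GL_def bij_def image_comp o_def surj_f_inv_f inv_f_f)

lemma GL_cov: "g \<in> GL scale \<Longrightarrow> cov z w \<Longrightarrow> cov (g ` z) (g ` w)"
  using GL_image by (auto simp: cov_def)

lemma rho_VV:
  assumes "g \<in> GL scale" "\<phi> \<in> VV scale r" shows "rho g \<phi> \<in> VV scale r"
proof -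
  have "inv g ` x \<notin> Gr scale r" if "x \<notin> Gr scale r" for x
    using GL_image[OF assms(1), of "inv g ` x"] that GL_inv_image(2)[OF assms(1), of x]
    unfolding Gr_iff by metis
  then show ?thesis using assms(2) unfolding VV_def rho_def by blast
qed

lemma rho_add: "rho g (\<phi> + \<psi>) = rho g \<phi> + rho g \<psi>"
  and rho_cscale: "rho g (cscale c \<phi>) = cscale c (rho g \<phi>)"
  by (simp_all add: rho_def cscale_def fun_eq_iff)

lemma rho_sum: "rho g (\<Sum>i\<in>I. f i) = (\<Sum>i\<in>I. rho g (f i))"
  by (induction I rule: infinite_finite_induct) (simp_all add: rho_def fun_eq_iff)

lemma up_rho:
  assumes g: "g \<in> GL scale" shows "up (rho g \<phi>) = rho g (up \<phi>)"
proof
  fix w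
  show "up (rho g \<phi>) w = rho g (up \<phi>) w"
    unfolding up_def rho_def
    by (rule sum.reindex_bij_witness[of _ "image g" "image (inv g)"])
      (use GL_cov[OF g] GL_cov[OF GL_inv[OF g]] GL_inv_image[OF g] in \<open>auto, metis\<close>)
qed

lemma down_rho:
  assumes g: "g \<in> GL scale" shows "down (rho g \<phi>) = rho g (down \<phi>)"
proof
  fix z
  show "down (rho g \<phi>) z = rho g (down \<phi>) z"
    unfolding down_def rho_def
    by (rule sum.reindex_bij_witness[of _ "image g" "image (inv g)"])
      (use GL_cov[OF g] GL_cov[OF GL_inv[OF g]] GL_inv_image[OF g] in \<open>auto, metis\<close>)
qed

text \<open>By \<open>down_up\<close> the Laplacian is \<open>down \<circ> up\<close> minus a
  scalar, and it inherits equivariance from the two factors.\<close>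

lemma laplacian_rho:
  assumes g: "g \<in> GL scale" and \<phi>: "\<phi> \<in> VV scale r"
  shows "laplacian scale r (rho g \<phi>) = rho g (laplacian scale r \<phi>)"
  using down_up[OF \<phi>] down_up[OF rho_VV[OF g \<phi>]] up_rho[OF g] down_rho[OF g]
  by (simp add: rho_add rho_cscale)

end

section \<open>Schur's lemma and the spectrum of the Laplacian\<close>

lemma lin_map_zero:
  assumes "lin_map U W T" "cfun.subspace U" shows "T 0 = 0"
proof -
  have 0: "0 \<in> U" using assms(2) by (rule cfun.subspace_0)
  then have "T (cscale 0 0) = cscale 0 (T 0)" using assms(1) unfolding lin_map_def by blast
  then show ?thesis by simp
qed

lemma lin_map_add: "lin_map U W T \<Longrightarrow> u \<in> U \<Longrightarrow> v \<in> U \<Longrightarrow> T (u + v) = T u + T v"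
  and lin_map_cscale: "lin_map U W T \<Longrightarrow> u \<in> U \<Longrightarrow> T (cscale c u) = cscale c (T u)"
  and lin_map_mem: "lin_map U W T \<Longrightarrow> u \<in> U \<Longrightarrow> T u \<in> W"
  by (simp_all add: lin_map_def)

lemma lin_map_diff:
  assumes "lin_map U W T" "cfun.subspace U" "u \<in> U" "v \<in> U"
  shows "T (u - v) = T u - T v"
proof -
  have "T u = T ((u - v) + v)" by simp
  also have "\<dots> = T (u - v) + T v"
    using assms by (intro lin_map_add[OF assms(1)] cfun.subspace_diff) auto
  finally show ?thesis by simp
qed

lemma lin_map_sum:
  assumes "lin_map U W T" "cfun.subspace U" "\<And>i. i \<in> I \<Longrightarrow> f i \<in> U"
  shows "T (\<Sum>i\<in>I. f i) = (\<Sum>i\<in>I. T (f i))"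
  using assms(3)
proof (induction I rule: infinite_finite_induct)
  case (insert i I)
  have "sum f I \<in> U"
    using insert.prems by (intro cfun.subspace_sum[OF assms(2)]) auto
  then have "T (f i + sum f I) = T (f i) + T (sum f I)"
    using insert.prems by (intro lin_map_add[OF assms(1)]) auto
  also have "T (sum f I) = (\<Sum>i\<in>I. T (f i))" using insert by blast
  finally show ?case by (simp only: sum.insert[OF insert.hyps])
qed (simp_all add: lin_map_zero[OF assms(1,2)])

text \<open>Kernel and image are invariant subspaces; by irreducibility and
  \<open>T u0 \<noteq> 0\<close> the kernel is trivial and the image is everything.\<close>

lemma schur:
  assumes U: "irreducible_rep G U \<pi>" and W: "irreducible_rep G W \<sigma>"
    and T: "equivariant G U \<pi> W \<sigma> T" and nz: "u0 \<in> U" "T u0 \<noteq> 0"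
  shows "equivalent_rep G U \<pi> W \<sigma>"
proof -
  have subU: "cfun.subspace U" and piU: "\<And>g u. g \<in> G \<Longrightarrow> u \<in> U \<Longrightarrow> \<pi> g u \<in> U"
    and linU: "\<And>g. g \<in> G \<Longrightarrow> lin_map U U (\<pi> g)"
    and irrU: "\<And>K. cfun.subspace K \<Longrightarrow> K \<subseteq> U \<Longrightarrow> (\<And>g w. g \<in> G \<Longrightarrow> w \<in> K \<Longrightarrow> \<pi> g w \<in> K) \<Longrightarrow> K = {0} \<or> K = U"
    using U by (auto simp: irreducible_rep_def representation_def lin_map_def)
  have subW: "cfun.subspace W" and linW: "\<And>g. g \<in> G \<Longrightarrow> lin_map W W (\<sigma> g)"
    and irrW: "\<And>K. cfun.subspace K \<Longrightarrow> K \<subseteq> W \<Longrightarrow> (\<And>g w. g \<in> G \<Longrightarrow> w \<in> K \<Longrightarrow> \<sigma> g w \<in> K) \<Longrightarrow> K = {0} \<or> K = W"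
    using W by (auto simp: irreducible_rep_def representation_def)
  have lin: "lin_map U W T" and equ: "\<And>g u. g \<in> G \<Longrightarrow> u \<in> U \<Longrightarrow> T (\<pi> g u) = \<sigma> g (T u)"
    using T by (auto simp: equivariant_def)
  note T0 = lin_map_zero[OF lin subU]
  define K where "K = {u\<in>U. T u = 0}"
  have "K = {0} \<or> K = U"
  proof (rule irrU)
    show "cfun.subspace K"
      using subU T0 lin_map_add[OF lin] lin_map_cscale[OF lin]
      by (auto simp: K_def cfun.subspace_def)
    show "K \<subseteq> U" by (auto simp: K_def)
    show "\<pi> g w \<in> K" if "g \<in> G" "w \<in> K" for g w
      using that piU equ lin_map_zero[OF linW subW] by (auto simp: K_def)
  qed
  then have K: "K = {0}" using nz by (auto simp: K_def)
  have "inj_on T U"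
  proof (rule inj_onI)
    fix u v assume uv: "u \<in> U" "v \<in> U" "T u = T v"
    then have "u - v \<in> K"
      using lin_map_diff[OF lin subU] cfun.subspace_diff[OF subU] by (simp add: K_def)
    then show "u = v" using K by simp
  qed
  moreover have "T ` U = {0} \<or> T ` U = W"
  proof (rule irrW)
    show "cfun.subspace (T ` U)"
      unfolding cfun.subspace_def
    proof (intro conjI ballI allI)
      show "0 \<in> T ` U" using T0 cfun.subspace_0[OF subU] by force
      show "x + y \<in> T ` U" if "x \<in> T ` U" "y \<in> T ` U" for x y
        using that lin_map_add[OF lin] cfun.subspace_add[OF subU] by (auto simp flip: lin_map_add[OF lin])
      show "cscale c x \<in> T ` U" if "x \<in> T ` U" for c x
        using that cfun.subspace_scale[OF subU] by (auto simp flip: lin_map_cscale[OF lin])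
    qed
    show "T ` U \<subseteq> W" using lin by (auto simp: lin_map_def)
    show "\<sigma> g w \<in> T ` U" if "g \<in> G" "w \<in> T ` U" for g w
      using that piU by (auto simp flip: equ)
  qed
  then have "T ` U = W" using nz by auto
  ultimately show ?thesis
    using T by (auto simp: equivalent_rep_def bij_betw_def)
qed

lemma equivalent_rep_trans:
  assumes "equivalent_rep G U \<pi> V \<sigma>" "equivalent_rep G V \<sigma> W \<tau>"
  shows "equivalent_rep G U \<pi> W \<tau>"
proof -
  obtain S T where S: "equivariant G U \<pi> V \<sigma> S" "bij_betw S U V"
    and T: "equivariant G V \<sigma> W \<tau> T" "bij_betw T V W"
    using assms by (auto simp: equivalent_rep_def)
  then have "equivariant G U \<pi> W \<tau> (T \<circ> S)" by (auto simp: equivariant_def lin_map_def)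
  moreover have "bij_betw (T \<circ> S) U W" using S T bij_betw_trans by blast
  ultimately show ?thesis by (auto simp: equivalent_rep_def)
qed

lemma equivalent_rep_sym:
  assumes "equivalent_rep G U \<pi> V \<sigma>" and U: "representation G U \<pi>"
  shows "equivalent_rep G V \<sigma> U \<pi>"
proof -
  obtain S where S: "equivariant G U \<pi> V \<sigma> S" "bij_betw S U V"
    using assms by (auto simp: equivalent_rep_def)
  let ?T = "the_inv_into U S"
  have subU: "cfun.subspace U" and piU: "\<And>g u. g \<in> G \<Longrightarrow> u \<in> U \<Longrightarrow> \<pi> g u \<in> U"
    using U by (auto simp: representation_def lin_map_def)
  have lin: "lin_map U V S" and equ: "\<And>g u. g \<in> G \<Longrightarrow> u \<in> U \<Longrightarrow> S (\<pi> g u) = \<sigma> g (S u)"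
    using S by (auto simp: equivariant_def)
  have V: "V = S ` U" and TS: "\<And>u. u \<in> U \<Longrightarrow> ?T (S u) = u"
    using S(2) by (auto simp: bij_betw_def the_inv_into_f_f)
  have "equivariant G V \<sigma> U \<pi> ?T"
    unfolding equivariant_def lin_map_def V
  proof (intro conjI ballI allI; elim imageE; clarify)
    fix u v assume uv: "u \<in> U" "v \<in> U"
    show "?T (S u + S v) = ?T (S u) + ?T (S v)"
      using uv cfun.subspace_add[OF subU] by (simp add: TS flip: lin_map_add[OF lin])
  next
    fix c u assume u: "u \<in> U"
    show "?T (cscale c (S u)) = cscale c (?T (S u))"
      using u cfun.subspace_scale[OF subU] by (simp add: TS flip: lin_map_cscale[OF lin])
  next
    fix g u assume u: "u \<in> U" "g \<in> G"
    show "?T (\<sigma> g (S u)) = \<pi> g (?T (S u))"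
      using u piU by (simp add: TS flip: equ)
  qed (simp add: TS)
  moreover have "bij_betw ?T V U" using S(2) by (rule bij_betw_the_inv_into)
  ultimately show ?thesis by (auto simp: equivalent_rep_def)
qed

section \<open>Constituents, projections onto them and images under equivariant maps\<close>

locale decomposed_grassmannians = finite_field_space scale Basis
  for scale :: "'k::{field,finite} \<Rightarrow> 'v::ab_group_add \<Rightarrow> 'v" (infixr \<open>*s\<close> 75)
    and Basis :: "'v set" +
  fixes U :: "nat \<Rightarrow> ('i \<Rightarrow> complex) set"
    and \<pi> :: "nat \<Rightarrow> ('v \<Rightarrow> 'v) \<Rightarrow> ('i \<Rightarrow> complex) \<Rightarrow> ('i \<Rightarrow> complex)"
    and W :: "nat \<Rightarrow> nat \<Rightarrow> ('v set \<Rightarrow> complex) set"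
  assumes decomposition: "grassmann_decomposition scale (card Basis) U \<pi> W"
begin

context
  fixes r assumes r: "r \<le> n"
begin

lemma W_VV: "s \<le> min r (n - r) \<Longrightarrow> W r s \<subseteq> VV scale r"
  and W_irreducible: "s \<le> min r (n - r) \<Longrightarrow> irreducible_rep (GL scale) (W r s) rho"
  and W_equivalent: "s \<le> min r (n - r) \<Longrightarrow> equivalent_rep (GL scale) (W r s) rho (U s) (\<pi> s)"
  and W_orthogonal: "s \<le> min r (n - r) \<Longrightarrow> s' \<le> min r (n - r) \<Longrightarrow> s \<noteq> s' \<Longrightarrow>
    \<phi> \<in> W r s \<Longrightarrow> \<psi> \<in> W r s' \<Longrightarrow> VV_inner scale r \<phi> \<psi> = 0"
  and VV_eq_sum_W:
    "VV scale r = {\<Sum>s\<le>min r (n - r). f s | f. \<forall>s\<le>min r (n - r). f s \<in> W r s}"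
  using decomposition r unfolding grassmann_decomposition_def by blast+

lemma W_subspace: "s \<le> min r (n - r) \<Longrightarrow> cfun.subspace (W r s)"
  and W_rho: "s \<le> min r (n - r) \<Longrightarrow> g \<in> GL scale \<Longrightarrow> \<phi> \<in> W r s \<Longrightarrow> rho g \<phi> \<in> W r s"
  and W_representation: "s \<le> min r (n - r) \<Longrightarrow> Defs.representation (GL scale) (W r s) rho"
  using W_irreducible[of s] unfolding irreducible_rep_def Defs.representation_def lin_map_def
  by blast+

lemma W_nonzero: assumes "s \<le> min r (n - r)" obtains \<phi> where "\<phi> \<in> W r s" "\<phi> \<noteq> 0"
proof -
  have "W r s \<noteq> {0}" using W_irreducible[OF assms] by (simp add: irreducible_rep_def)
  then show ?thesis using that cfun.subspace_0[OF W_subspace[OF assms]] by blast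
qed

lemma VV_inner_sum_left:
  "VV_inner scale r (\<Sum>i\<in>I. f i) \<psi> = (\<Sum>i\<in>I. VV_inner scale r (f i) \<psi>)"
  by (induction I rule: infinite_finite_induct)
    (simp_all add: VV_inner_def distrib_right sum.distrib)

text \<open>Pairing the vanishing sum of the differences with its own term at \<open>s\<close>
  leaves, by orthogonality, only the squared norm of that term.\<close>

lemma components_unique:
  assumes f: "\<And>s. s \<le> min r (n - r) \<Longrightarrow> f s \<in> W r s" and g: "\<And>s. s \<le> min r (n - r) \<Longrightarrow> g s \<in> W r s"
    and eq: "(\<Sum>s\<le>min r (n - r). f s) = (\<Sum>s\<le>min r (n - r). g s)" and s: "s \<le> min r (n - r)"
  shows "f s = g s"
proof -
  define h where "h s = f s - g s" for s
  have h: "h s \<in> W r s" if "s \<le> min r (n - r)" for s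
    unfolding h_def using W_subspace that f g by (intro cfun.subspace_diff) auto
  have "(\<Sum>s\<le>min r (n - r). h s) = 0" by (simp only: h_def sum_subtractf eq diff_self)
  then have "0 = VV_inner scale r (\<Sum>s\<le>min r (n - r). h s) (h s)" by (simp add: VV_inner_def)
  also have "\<dots> = (\<Sum>i\<le>min r (n - r). if i = s then VV_inner scale r (h s) (h s) else 0)"
    unfolding VV_inner_sum_left using W_orthogonal h s by (intro sum.cong) auto
  also have "\<dots> = VV_inner scale r (h s) (h s)" using s by simp
  finally have "h s = 0" using VV_inner_self_0 W_VV h s by (metis subsetD)
  then show ?thesis by (simp add: h_def)
qed

text \<open>The projections onto the constituents. By \<open>components_unique\<close> the choice is
  forced for indices up to \<open>min r (n - r)\<close>.\<close>

definition component :: "('v set \<Rightarrow> complex) \<Rightarrow> nat \<Rightarrow> 'v set \<Rightarrow> complex" where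
  "component \<psi> = (SOME f. (\<forall>s\<le>min r (n - r). f s \<in> W r s) \<and> \<psi> = (\<Sum>s\<le>min r (n - r). f s))"

lemma component:
  assumes "\<psi> \<in> VV scale r"
  shows "s \<le> min r (n - r) \<Longrightarrow> component \<psi> s \<in> W r s" and "(\<Sum>s\<le>min r (n - r). component \<psi> s) = \<psi>"
proof -
  have "\<exists>f. (\<forall>s\<le>min r (n - r). f s \<in> W r s) \<and> \<psi> = (\<Sum>s\<le>min r (n - r). f s)"
    using assms unfolding VV_eq_sum_W by auto
  from someI_ex[OF this] show "s \<le> min r (n - r) \<Longrightarrow> component \<psi> s \<in> W r s"
    and "(\<Sum>s\<le>min r (n - r). component \<psi> s) = \<psi>"
    unfolding component_def by auto
qed

lemma component_eqI:
  assumes "\<And>s. s \<le> min r (n - r) \<Longrightarrow> f s \<in> W r s" "(\<Sum>s\<le>min r (n - r). f s) = \<psi>"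
    and "\<psi> \<in> VV scale r" "s \<le> min r (n - r)"
  shows "component \<psi> s = f s"
  using components_unique[of "component \<psi>" f s] component[OF assms(3)] assms by auto

text \<open>Adding, scaling or translating the components termwise gives a decomposition of the new
  function, which by uniqueness is its own.\<close>

lemma equivariant_component:
  assumes s: "s \<le> min r (n - r)"
  shows "equivariant (GL scale) (VV scale r) rho (W r s) rho (\<lambda>\<psi>. component \<psi> s)"
  unfolding equivariant_def lin_map_def
proof (intro conjI ballI allI)
  show "component \<psi> s \<in> W r s" if "\<psi> \<in> VV scale r" for \<psi> using component that s by blast
  show "component (\<phi> + \<psi>) s = component \<phi> s + component \<psi> s" if "\<phi> \<in> VV scale r" "\<psi> \<in> VV scale r" for \<phi> \<psi>
    using that s
    by (intro component_eqI[of "\<lambda>s. component \<phi> s + component \<psi> s"])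
      (simp_all only: VV_add sum.distrib component(2), intro cfun.subspace_add[OF W_subspace] component(1))
  show "component (cscale c \<psi>) s = cscale c (component \<psi> s)" if "\<psi> \<in> VV scale r" for c \<psi>
    using that s
    by (intro component_eqI[of "\<lambda>s. cscale c (component \<psi> s)"])
      (simp_all only: VV_cscale component(2) cfun.scale_sum_right[symmetric], intro cfun.subspace_scale[OF W_subspace] component(1))
  show "component (rho g \<psi>) s = rho g (component \<psi> s)" if "g \<in> GL scale" "\<psi> \<in> VV scale r" for g \<psi>
    using that s
    by (intro component_eqI[of "\<lambda>s. rho g (component \<psi> s)"])
      (simp_all only: rho_VV component(2) rho_sum[symmetric], intro W_rho component(1))
qed

end

lemma equivalent_W_imp_eq:
  assumes "r \<le> n" "r' \<le> n" and s: "s \<le> min r (n - r)" "s' \<le> min r' (n - r')"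
    and eq: "equivalent_rep (GL scale) (W r s) rho (W r' s') rho"
  shows "s = s'"
proof (rule ccontr)
  assume "s \<noteq> s'"
  have "equivalent_rep (GL scale) (U s) (\<pi> s) (W r s) rho"
    using W_equivalent W_representation assms equivalent_rep_sym by metis
  then have "equivalent_rep (GL scale) (U s) (\<pi> s) (U s') (\<pi> s')"
    using W_equivalent assms equivalent_rep_trans by metis
  moreover have "2 * s \<le> n" "2 * s' \<le> n" using assms by auto
  ultimately show False
    using decomposition \<open>s \<noteq> s'\<close> unfolding grassmann_decomposition_def by blast
qed

text \<open>Following \<open>T\<close> by the projection onto a constituent with another index gives
  an equivariant map between inequivalent irreducible spaces, which vanishes by
  \<open>schur\<close>.\<close>

lemma equivariant_image:
  assumes r: "r \<le> n" "r' \<le> n" and s: "s \<le> min r (n - r)"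
    and T: "equivariant (GL scale) (W r s) rho (VV scale r') rho T" and \<phi>: "\<phi> \<in> W r s"
  shows "s \<le> min r' (n - r') \<Longrightarrow> T \<phi> \<in> W r' s" and "\<not> s \<le> min r' (n - r') \<Longrightarrow> T \<phi> = 0"
proof -
  let ?m = "min r' (n - r')"
  have T\<phi>: "T \<phi> \<in> VV scale r'" using T \<phi> by (simp add: equivariant_def lin_map_def)
  have zero: "component r' (T \<phi>) s' = 0" if "s' \<le> ?m" "s' \<noteq> s" for s'
  proof (rule ccontr)
    assume nz: "component r' (T \<phi>) s' \<noteq> 0"
    have "equivariant (GL scale) (W r s) rho (W r' s') rho (\<lambda>\<phi>. component r' (T \<phi>) s')"
      using T equivariant_component[OF r(2) that(1)] by (auto simp: equivariant_def lin_map_def)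
    then have "equivalent_rep (GL scale) (W r s) rho (W r' s') rho"
      using schur[OF W_irreducible[OF r(1) s] W_irreducible[OF r(2) that(1)] _ \<phi>] nz by blast
    then show False using equivalent_W_imp_eq r s that by blast
  qed
  have "T \<phi> = (\<Sum>s'\<le>?m. component r' (T \<phi>) s')" using component(2)[OF r(2) T\<phi>] by simp
  also have "\<dots> = (\<Sum>s'\<le>?m. if s' = s then component r' (T \<phi>) s else 0)"
    using zero by (intro sum.cong) auto
  finally have eq: "T \<phi> = (\<Sum>s'\<le>?m. if s' = s then component r' (T \<phi>) s else 0)" .
  show "s \<le> ?m \<Longrightarrow> T \<phi> \<in> W r' s"
    using eq component(1)[OF r(2) T\<phi>, of s] by (simp add: sum.delta)
  show "\<not> s \<le> ?m \<Longrightarrow> T \<phi> = 0"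
    by (subst eq, intro sum.neutral) auto
qed

section \<open>Eigenvalues of the Laplacian on the constituents\<close>

lemma equivariant_up:
  assumes "r \<le> n" "s \<le> min r (n - r)"
  shows "equivariant (GL scale) (W r s) rho (VV scale (Suc r)) rho up"
  using W_VV[OF assms] by (auto simp: equivariant_def lin_map_def up_add up_cscale up_rho up_VV)

lemma equivariant_down:
  assumes "Suc r \<le> n" "s \<le> min (Suc r) (n - Suc r)"
  shows "equivariant (GL scale) (W (Suc r) s) rho (VV scale r) rho down"
  using W_VV[OF assms] by (auto simp: equivariant_def lin_map_def down_add down_cscale down_rho down_VV)

lemma laplacian_if_down_zero:
  assumes "\<phi> \<in> VV scale r" "down \<phi> = 0" "r \<le> n"
  shows "laplacian scale r \<phi> =
    cscale (- of_nat (qnum CARD('k) r * qnum CARD('k) (Suc (n - r)))) \<phi>"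
proof -
  have "laplacian scale r \<phi> + cscale (of_nat (qnum CARD('k) r * qnum CARD('k) (Suc (n - r)))) \<phi> = 0"
    using up_down[OF assms(1,3)] assms(2) up_zero by metis
  then show ?thesis by (simp only: eq_neg_iff_add_eq_0 cfun.scale_minus_left)
qed

text \<open>Induction on the level. A constituent that first appears at this level is annihilated by
  \<open>down\<close>. Any other one gets its eigenvalue from the level below, through injectivity
  of \<open>up\<close> in the lower half and of \<open>down\<close> in the upper half.\<close>

theorem laplacian_W:
  assumes "r \<le> n" "s \<le> min r (n - r)" "\<phi> \<in> W r s"
  shows "laplacian scale r \<phi> =
    cscale (- of_nat (qnum CARD('k) s * qnum CARD('k) (Suc (n - s)))) \<phi>"
  using assms
proof (induction r arbitrary: \<phi>)
  case 0
  then have "\<phi> \<in> VV scale 0" using W_VV[of 0 s] by auto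
  then show ?case using laplacian_if_down_zero[OF _ down_VV_0] 0 by simp
next
  case (Suc r)
  let ?c = "- of_nat (qnum CARD('k) s * qnum CARD('k) (Suc (n - s))) :: complex"
  have r: "r \<le> n" "r < n" using Suc by auto
  have VV: "W (Suc r) s \<subseteq> VV scale (Suc r)" using W_VV Suc by blast
  consider "s = Suc r" | "s \<le> r" "2 * r < n" | "s \<le> r" "n < 2 * Suc r"
  proof atomize_elim
    have "s \<le> Suc r" using Suc.prems(2) by simp
    then show "s = Suc r \<or> s \<le> r \<and> 2 * r < n \<or> s \<le> r \<and> n < 2 * Suc r" by arith
  qed
  then show ?case
  proof cases
    case 1
    \<comment> \<open>The index \<open>Suc r\<close> exceeds \<open>min r (n - r)\<close>, so no
      constituent at level \<open>r\<close> can receive the image.\<close>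
    then have "down \<phi> = 0"
      using equivariant_image(2)[OF Suc.prems(1) r(1) Suc.prems(2)
        equivariant_down[OF Suc.prems(1,2)] Suc.prems(3)] by simp
    then show ?thesis using laplacian_if_down_zero 1 VV Suc.prems by blast
  next
    case 2
    then have s: "s \<le> min r (n - r)" using Suc.prems by simp
    \<comment> \<open>The eigenspace inside the constituent is invariant, so by irreducibility one
      nonzero eigenvector, \<open>up \<psi>\<close>, makes it the whole constituent.\<close>
    let ?E = "{\<phi>\<in>W (Suc r) s. laplacian scale (Suc r) \<phi> = cscale ?c \<phi>}"
    obtain \<psi> where \<psi>: "\<psi> \<in> W r s" "\<psi> \<noteq> 0" using W_nonzero[OF r(1) s] .
    then have \<psi>V: "\<psi> \<in> VV scale r" using W_VV[OF r(1) s] by blast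
    have "up \<psi> \<in> W (Suc r) s"
      using equivariant_image(1)[OF r(1) Suc.prems(1) s equivariant_up[OF r(1) s] \<psi>(1) Suc.prems(2)] .
    moreover have "laplacian scale (Suc r) (up \<psi>) = cscale ?c (up \<psi>)"
      unfolding laplacian_up[OF \<psi>V r(2)] Suc.IH[OF r(1) s \<psi>(1)] up_cscale ..
    ultimately have "up \<psi> \<in> ?E" by simp
    moreover have "up \<psi> \<noteq> 0" using up_inj[OF \<psi>V] 2 \<psi> by blast
    moreover have "?E = {0} \<or> ?E = W (Suc r) s"
    proof -
      note sub = W_subspace[OF Suc.prems(1,2)]
      have "cfun.subspace ?E"
        unfolding cfun.subspace_def
      proof (intro conjI ballI allI)
        have "laplacian scale (Suc r) 0 = 0" by (auto simp: laplacian_def)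
        then show "0 \<in> ?E" using cfun.subspace_0[OF sub] by simp
        show "x + y \<in> ?E" if "x \<in> ?E" "y \<in> ?E" for x y
          using that cfun.subspace_add[OF sub, of x y]
          by (simp only: mem_Collect_eq laplacian_add cfun.scale_right_distrib)
        show "cscale a x \<in> ?E" if "x \<in> ?E" for a x
          using that cfun.subspace_scale[OF sub, of x a]
          by (simp only: mem_Collect_eq laplacian_cscale cfun.scale_left_commute)
      qed
      moreover have "rho g w \<in> ?E" if "g \<in> GL scale" "w \<in> ?E" for g w
      proof -
        have w: "w \<in> W (Suc r) s" "laplacian scale (Suc r) w = cscale ?c w" using that by auto
        then have "w \<in> VV scale (Suc r)" using VV by blast
        from laplacian_rho[OF that(1) this]
        have "laplacian scale (Suc r) (rho g w) = cscale ?c (rho g w)"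
          unfolding w(2) rho_cscale .
        then show ?thesis using W_rho[OF Suc.prems(1,2) that(1) w(1)] by blast
      qed
      moreover have "?E \<subseteq> W (Suc r) s" by blast
      ultimately show ?thesis
        using W_irreducible[OF Suc.prems(1,2)] unfolding irreducible_rep_def by blast
    qed
    ultimately show ?thesis using Suc.prems(3) by blast
  next
    case 3
    then have s: "s \<le> min r (n - r)" using Suc.prems by simp
    have \<phi>: "\<phi> \<in> VV scale (Suc r)" using VV Suc.prems by blast
    have "down \<phi> \<in> W r s"
      using equivariant_image(1)[OF Suc.prems(1) r(1) Suc.prems(2) equivariant_down[OF Suc.prems(1,2)] Suc.prems(3) s] .
    \<comment> \<open>The eigenvalue equation holds after applying \<open>down\<close>, which is
      injective at this level.\<close>
    from Suc.IH[OF r(1) s this] have "down (laplacian scale (Suc r) \<phi>) = down (cscale ?c \<phi>)"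
      by (simp only: laplacian_down[OF \<phi> r(2)] down_cscale)
    then have "down (laplacian scale (Suc r) \<phi> - cscale ?c \<phi>) = 0" by (simp only: down_diff diff_self)
    then have "laplacian scale (Suc r) \<phi> - cscale ?c \<phi> = 0"
      by (rule down_inj[OF VV_diff[OF laplacian_VV VV_cscale[OF \<phi>]] 3(2) Suc.prems(1)])
    then show ?thesis by (simp only: right_minus_eq)
  qed
qed

text \<open>The other constituents are orthogonal to \<open>W r1 s\<close> and are sent to 0, so
  only the component at \<open>s\<close> contributes.\<close>

lemma extended_equivariant_image:
  assumes r: "r1 \<le> n" "r2 \<le> n" and s: "s \<le> NN n r1 r2"
    and \<Lambda>: "extended_equivariant scale r1 (W r1 s) r2 (W r2 s) \<Lambda>" and \<phi>: "\<phi> \<in> VV scale r1"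
  shows "\<Lambda> \<phi> \<in> W r2 s"
proof -
  let ?m = "min r1 (n - r1)"
  have s1: "s \<le> ?m" using s by (simp add: NN_def)
  have lin: "lin_map (VV scale r1) (VV scale r2) \<Lambda>" and linW: "lin_map (W r1 s) (W r2 s) \<Lambda>"
    using \<Lambda> by (auto simp: extended_equivariant_def equivariant_def)
  have component_VV: "component r1 \<phi> s' \<in> VV scale r1" if "s' \<le> ?m" for s'
    using component(1)[OF r(1) \<phi> that] W_VV[OF r(1) that] by blast
  have zero: "\<Lambda> (component r1 \<phi> s') = 0" if "s' \<le> ?m" "s' \<noteq> s" for s'
    using \<Lambda> component(1)[OF r(1) \<phi> that(1)] W_orthogonal[OF r(1) that(1) s1 that(2)] component_VV[OF that(1)]
    unfolding extended_equivariant_def by blast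
  have "\<Lambda> \<phi> = \<Lambda> (\<Sum>s'\<le>?m. component r1 \<phi> s')" using component(2)[OF r(1) \<phi>] by simp
  also have "\<dots> = (\<Sum>s'\<le>?m. \<Lambda> (component r1 \<phi> s'))"
    using component_VV by (intro lin_map_sum[OF lin subspace_VV]) auto
  also have "\<dots> = (\<Sum>s'\<le>?m. if s' = s then \<Lambda> (component r1 \<phi> s) else 0)"
    using zero by (intro sum.cong) auto
  also have "\<dots> = \<Lambda> (component r1 \<phi> s)" using s1 by simp
  finally show ?thesis using lin_map_mem[OF linW] component(1)[OF r(1) \<phi> s1] by simp
qed

end

section \<open>A q-difference equation\<close>

lemma qpoch_0 [simp]: "qpoch u p 0 = 1"
  by (simp add: qpoch_def)

lemma qpoch_Suc: "qpoch u p (Suc k) = qpoch u p k * (1 - p ^ k * u)"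
  by (simp add: qpoch_def)

lemma qpoch_nonzero: "(\<And>j. j < k \<Longrightarrow> p ^ j * u \<noteq> 1) \<Longrightarrow> qpoch u p k \<noteq> 0"
  by (auto simp: qpoch_def)

lemma qpoch_1: "qpoch 1 p (Suc k) = 0"
  unfolding qpoch_def by (rule prod_zero) (auto intro!: bexI[of _ 0])

text \<open>The constant part of a term of the series. The factorial of the second upper parameter
  and the variable part of the argument are left to the basis functions.\<close>

definition hyp_coeff ::
  "complex \<Rightarrow> nat \<Rightarrow> complex \<Rightarrow> complex \<Rightarrow> complex \<Rightarrow> complex \<Rightarrow> nat \<Rightarrow> complex" where
  "hyp_coeff q s m d1 d2 z k =
     qpoch (q ^ s) (inverse q) k * qpoch m (inverse q) k /
     (qpoch (inverse q) (inverse q) k * qpoch d1 (inverse q) k * qpoch d2 (inverse q) k) * z ^ k"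

text \<open>The factor with index \<open>s\<close> in \<open>qpoch (q ^ s) (inverse q) k\<close> is
  0 as soon as \<open>k > s\<close>.\<close>

lemma phi32_terminating:
  assumes "q \<noteq> 0"
  shows "phi32 (q ^ s) x m d1 d2 (inverse q) (z * y) =
    (\<Sum>k\<le>s. hyp_coeff q s m d1 d2 z k * (qpoch x (inverse q) k * y ^ k))"
proof -
  have "qpoch (q ^ s) (inverse q) k = 0" if "k > s" for k
    unfolding qpoch_def using assms that
    by (intro prod_zero) (auto intro!: bexI[of _ s] simp: field_simps)
  then have "phi32 (q ^ s) x m d1 d2 (inverse q) (z * y) =
    (\<Sum>k\<le>s. (qpoch (q ^ s) (inverse q) k * qpoch x (inverse q) k * qpoch m (inverse q) k) /
          (qpoch (inverse q) (inverse q) k * qpoch d1 (inverse q) k * qpoch d2 (inverse q) k) * (z * y) ^ k)"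
    unfolding phi32_def by (intro suminf_finite) (auto simp: not_le)
  then show ?thesis by (simp add: hyp_coeff_def power_mult_distrib mult_ac)
qed

text \<open>At \<open>u = q powi (- t)\<close> with the parameters of \<open>kernel_recurrence\<close>, \<open>qdiff\<close> is
  \<open>(q - 1)\<^sup>2 u\<^sup>2\<close> times the Laplacian on functions of the distance \<open>t\<close> to a fixed subspace.\<close>

definition qdiff ::
  "complex \<Rightarrow> complex \<Rightarrow> complex \<Rightarrow> complex \<Rightarrow> complex \<Rightarrow> complex \<Rightarrow> (complex \<Rightarrow> complex) \<Rightarrow> complex \<Rightarrow> complex" where
  "qdiff q Q a1 a2 b1 b2 G u =
     Q * (u - b1) * (u - b2) * (G (u / q) - G u) + (u - a1) * (u - a2) * (G (q * u) - G u)"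

text \<open>The basis lemmas below single out \<open>a1\<close> or \<open>b1\<close>; by symmetry
  each of the four roots can be singled out.\<close>

lemma qdiff_swap: "qdiff q Q a1 a2 b1 b2 = qdiff q Q a2 a1 b1 b2"
  "qdiff q Q a1 a2 b1 b2 = qdiff q Q a1 a2 b2 b1"
  by (simp_all add: qdiff_def fun_eq_iff)

text \<open>Replacing \<open>u\<close> by \<open>q * u\<close> or \<open>u / q\<close> shifts the
  nodes by one place; the local facts \<open>up\<close> and \<open>down\<close> express this, the
  coefficient \<open>u - a1\<close> absorbing the node that is lost. In the cofactor of
  \<open>e k u\<close> the relation \<open>ab\<close> cancels the linear term, which leaves the
  factor \<open>u\<^sup>2\<close>.\<close>

lemma qdiff_newton_basis:
  fixes q :: complex
  assumes nz: "q \<noteq> 0" "a1 \<noteq> 0" "b1 \<noteq> 0" "b2 \<noteq> 0" and ab: "Q * b1 * b2 = q * a1 * a2"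
  defines "e \<equiv> \<lambda>k u. \<Prod>j<k. u - a1 / q ^ j"
  shows "qdiff q Q a1 a2 b1 b2 (e (Suc k)) u = u\<^sup>2 *
    ((q ^ Suc k - 1) * (1 - Q / q ^ Suc k) * e (Suc k) u
     - (q ^ Suc k - 1) * a2 * ((1 - a1 / b1 / q ^ k) * (1 - a1 / b2 / q ^ k)) * e k u)"
proof -
  have e_Suc: "e (Suc k) u = e k u * (u - a1 / q ^ k)" for k u by (simp add: e_def)
  have up: "(u - a1) * e (Suc k) (q * u) = q ^ Suc k * (u - a1 / q ^ Suc k) * e (Suc k) u" for k
  proof (induction k)
    case (Suc k)
    have "(u - a1) * e (Suc (Suc k)) (q * u) =
        ((u - a1) * e (Suc k) (q * u)) * (q * (u - a1 / q ^ Suc (Suc k)))"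
      using nz by (simp add: e_Suc[of "Suc k"] field_simps)
    then show ?case unfolding Suc by (simp add: e_Suc[of "Suc k"] mult_ac)
  qed (use nz in \<open>simp add: e_def field_simps\<close>)
  have down: "e (Suc k) (u / q) = (u - a1 * q) * e k u / q ^ Suc k" for k
  proof (induction k)
    case (Suc k)
    have "e (Suc (Suc k)) (u / q) = e (Suc k) (u / q) * ((u - a1 / q ^ k) / q)"
      using nz by (simp add: e_Suc[of "Suc k"] field_simps)
    then show ?case unfolding Suc by (simp add: e_Suc[of k] mult_ac)
  qed (use nz in \<open>simp add: e_def field_simps\<close>)
  define p where "p = q ^ k"
  have p: "p \<noteq> 0" using nz by (simp add: p_def)
  have "qdiff q Q a1 a2 b1 b2 (e (Suc k)) u =
      Q * (u - b1) * (u - b2) * ((u - a1 * q) * e k u / (q * p) - e k u * (u - a1 / p)) +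
      (u - a2) * (q * p * (u - a1 / (q * p)) * (e k u * (u - a1 / p)) - (u - a1) * (e k u * (u - a1 / p)))"
  proof -
    have "qdiff q Q a1 a2 b1 b2 (e (Suc k)) u =
      Q * (u - b1) * (u - b2) * (e (Suc k) (u / q) - e (Suc k) u) +
      (u - a2) * ((u - a1) * e (Suc k) (q * u) - (u - a1) * e (Suc k) u)"
      by (simp add: qdiff_def algebra_simps)
    then show ?thesis unfolding up down by (simp add: e_Suc p_def)
  qed
  also have "\<dots> = u\<^sup>2 * ((q * p - 1) * (1 - Q / (q * p)) * (e k u * (u - a1 / p))
     - (q * p - 1) * a2 * ((1 - a1 / b1 / p) * (1 - a1 / b2 / p)) * e k u)"
  proof -
    have Q: "Q = q * a1 * a2 / (b1 * b2)" using ab nz by (simp add: field_simps)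
    show ?thesis unfolding Q
      using nz p by (simp add: divide_simps) (simp add: algebra_simps power2_eq_square)
  qed
  finally show ?thesis by (simp add: e_Suc p_def)
qed

text \<open>Here the zeros \<open>b1 * q ^ j\<close> run in the opposite direction, so it is
  \<open>u - b1\<close> that absorbs the shift to \<open>u / q\<close>.\<close>

lemma qdiff_qpoch_basis:
  fixes q :: complex
  assumes nz: "q \<noteq> 0" "b1 \<noteq> 0" "Q \<noteq> 0" and ab: "Q * b1 * b2 = q * a1 * a2"
  defines "e \<equiv> \<lambda>k u. qpoch (u / b1) (inverse q) k"
  shows "qdiff q Q a1 a2 b1 b2 (e (Suc k)) u = u\<^sup>2 *
    ((q ^ Suc k - 1) * (1 - Q / q ^ Suc k) * e (Suc k) u
     - (q ^ Suc k - 1) * ((1 - a1 / b1 / q ^ k) * (1 - a2 / b1 / q ^ k)) * e k u)"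
proof -
  have e_Suc: "e (Suc k) u = e k u * (1 - u / b1 / q ^ k)" for k u
    by (simp add: e_def qpoch_Suc field_simps)
  have down: "(u - b1) * e (Suc k) (u / q) = - b1 * (1 - u / b1 / q ^ Suc k) * e (Suc k) u" for k
  proof (induction k)
    case (Suc k)
    have "(u - b1) * e (Suc (Suc k)) (u / q) =
        ((u - b1) * e (Suc k) (u / q)) * (1 - u / b1 / q ^ Suc (Suc k))"
      using nz by (simp add: e_Suc[of "Suc k"] field_simps)
    then show ?case unfolding Suc by (simp add: e_Suc[of "Suc k"] mult_ac)
  qed (use nz in \<open>simp add: e_def qpoch_Suc field_simps\<close>)
  have up: "e (Suc k) (q * u) = (1 - q * u / b1) * e k u" for k
  proof (induction k)
    case (Suc k)
    have "e (Suc (Suc k)) (q * u) = e (Suc k) (q * u) * (1 - u / b1 / q ^ k)"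
      using nz by (simp add: e_Suc[of "Suc k"] field_simps)
    then show ?case unfolding Suc by (simp add: e_Suc[of k] mult_ac)
  qed (use nz in \<open>simp add: e_def qpoch_Suc field_simps\<close>)
  define p where "p = q ^ k"
  have p: "p \<noteq> 0" using nz by (simp add: p_def)
  have "qdiff q Q a1 a2 b1 b2 (e (Suc k)) u =
      Q * (u - b2) * ((u - b1) * e (Suc k) (u / q) - (u - b1) * e (Suc k) u) +
      (u - a1) * (u - a2) * (e (Suc k) (q * u) - e (Suc k) u)"
    by (simp add: qdiff_def algebra_simps)
  also have "\<dots> =
      Q * (u - b2) * (- b1 * (1 - u / b1 / (q * p)) * (e k u * (1 - u / b1 / p)) - (u - b1) * (e k u * (1 - u / b1 / p))) +
      (u - a1) * (u - a2) * ((1 - q * u / b1) * e k u - e k u * (1 - u / b1 / p))"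
    unfolding down up by (simp add: e_Suc p_def)
  also have "\<dots> = u\<^sup>2 * ((q * p - 1) * (1 - Q / (q * p)) * (e k u * (1 - u / b1 / p))
     - (q * p - 1) * ((1 - a1 / b1 / p) * (1 - a2 / b1 / p)) * e k u)"
  proof -
    have b2: "b2 = q * a1 * a2 / (Q * b1)" using ab nz by (simp add: field_simps)
    show ?thesis unfolding b2
      using nz p by (simp add: divide_simps) (simp add: algebra_simps power2_eq_square)
  qed
  finally show ?thesis by (simp add: e_Suc p_def)
qed

text \<open>On a basis on which \<open>qdiff\<close> is bidiagonal up to \<open>u\<^sup>2\<close>,
  the eigenvalue equation becomes the recurrence \<open>c_rec\<close>, solved by the hypergeometric
  coefficients. The constant \<open>w\<close> accounts for the scaling of the basis:
  \<open>a2\<close> for the Newton basis, 1 for the q-shifted factorials.\<close>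

lemma qdiff_hyp_sum:
  fixes q :: complex
  assumes nz: "q \<noteq> 0" "w \<noteq> 0" and Q: "Q = m * q ^ s"
    and roots: "\<And>k. k < s \<Longrightarrow> q ^ Suc k \<noteq> 1 \<and> d1 / q ^ k \<noteq> 1 \<and> d2 / q ^ k \<noteq> 1"
    and e0: "e 0 = (\<lambda>u. 1)"
    and e_Suc: "\<And>k u. qdiff q Q a1 a2 b1 b2 (e (Suc k)) u = u\<^sup>2 *
      ((q ^ Suc k - 1) * (1 - Q / q ^ Suc k) * e (Suc k) u
       - (q ^ Suc k - 1) * w * ((1 - d1 / q ^ k) * (1 - d2 / q ^ k)) * e k u)"
  defines "c \<equiv> hyp_coeff q s m d1 d2 (inverse (q * w))"
  shows "qdiff q Q a1 a2 b1 b2 (\<lambda>u. \<Sum>k\<le>s. c k * e k u) u =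
    - ((q ^ s - 1) * (m - 1)) * u\<^sup>2 * (\<Sum>k\<le>s. c k * e k u)"
proof -
  define \<alpha> where "\<alpha> k = (q ^ k - 1) * (1 - Q / q ^ k)" for k
  define \<gamma> where "\<gamma> k = (q ^ Suc k - 1) * w * ((1 - d1 / q ^ k) * (1 - d2 / q ^ k))" for k
  define M where "M = (q ^ s - 1) * (m - 1)"
  have c_rec: "c (Suc k) * \<gamma> k = (\<alpha> k + M) * c k" if "k < s" for k
  proof -
    define D where "D = (1 - inverse q ^ Suc k) * (1 - d1 / q ^ k) * (1 - d2 / q ^ k)"
    have "1 - inverse q ^ Suc k \<noteq> 0"
      using roots[OF that] by (simp add: power_inverse inverse_eq_1_iff del: power_Suc)
    then have D: "D \<noteq> 0" using roots[OF that] by (simp add: D_def)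
    have 1: "c (Suc k) = c k * ((1 - q ^ s / q ^ k) * (1 - m / q ^ k)) / (D * (q * w))"
      by (simp add: c_def hyp_coeff_def qpoch_Suc D_def divide_inverse power_inverse mult_ac)
    have 2: "\<gamma> k = q ^ Suc k * w * D"
      using nz by (simp add: \<gamma>_def D_def field_simps)
    have 3: "\<alpha> k + M = q ^ k * ((1 - q ^ s / q ^ k) * (1 - m / q ^ k))"
      using nz by (simp add: \<alpha>_def M_def Q field_simps)
    show ?thesis unfolding 1 2 3 using nz D by (simp add: field_simps)
  qed
  have "qdiff q Q a1 a2 b1 b2 (\<lambda>u. \<Sum>k\<le>s. c k * e k u) u =
      (\<Sum>k\<le>s. c k * qdiff q Q a1 a2 b1 b2 (e k) u)"
    by (simp add: qdiff_def sum_distrib_left sum.distrib[symmetric] sum_subtractf[symmetric] algebra_simps)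
  also have "\<dots> = (\<Sum>k<s. c (Suc k) * (u\<^sup>2 * (\<alpha> (Suc k) * e (Suc k) u - \<gamma> k * e k u)))"
  proof -
    have "qdiff q Q a1 a2 b1 b2 (e 0) u = 0" by (simp add: e0 qdiff_def)
    then show ?thesis by (subst sum.atMost_shift) (simp add: e_Suc \<alpha>_def \<gamma>_def)
  qed
  also have "\<dots> = u\<^sup>2 * ((\<Sum>k<s. c (Suc k) * \<alpha> (Suc k) * e (Suc k) u) - (\<Sum>k<s. c (Suc k) * \<gamma> k * e k u))"
    by (simp add: sum_subtractf[symmetric] sum_distrib_left algebra_simps)
  also have "(\<Sum>k<s. c (Suc k) * \<alpha> (Suc k) * e (Suc k) u) = (\<Sum>k\<le>s. c k * \<alpha> k * e k u)"
    by (subst sum.atMost_shift) (simp add: \<alpha>_def)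
  also have "(\<Sum>k<s. c (Suc k) * \<gamma> k * e k u) = (\<Sum>k<s. (\<alpha> k + M) * c k * e k u)"
    by (intro sum.cong) (auto simp: c_rec)
  also have "\<dots> = (\<Sum>k\<le>s. (\<alpha> k + M) * c k * e k u)"
  proof -
    \<comment> \<open>The diagonal entry at \<open>s\<close> is the eigenvalue itself, so the sum
      may be extended to \<open>k = s\<close> and the series stops there.\<close>
    have "\<alpha> s + M = 0" using nz by (simp add: \<alpha>_def M_def Q algebra_simps)
    then show ?thesis by (simp add: lessThan_Suc_atMost[symmetric])
  qed
  also have "u\<^sup>2 * ((\<Sum>k\<le>s. c k * \<alpha> k * e k u) - \<dots>) = - M * u\<^sup>2 * (\<Sum>k\<le>s. c k * e k u)"
    by (simp add: sum_subtractf[symmetric] sum_distrib_left algebra_simps)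
  finally show ?thesis unfolding M_def .
qed

section \<open>Polynomial solutions of the q-difference equation\<close>

lemma degree_graded_sum:
  fixes p :: "nat \<Rightarrow> 'a::idom poly"
  assumes "\<And>k. degree (p k) = k" "c s \<noteq> 0" "p 0 \<noteq> 0"
  shows "degree (\<Sum>k\<le>s. smult (c k) (p k)) = s"
proof (cases s)
  case (Suc t)
  have "degree (\<Sum>k\<le>t. smult (c k) (p k)) \<le> t"
    by (intro degree_sum_le) (auto simp: assms(1) intro: order_trans[OF degree_smult_le])
  then show ?thesis
    using assms Suc by (simp add: degree_add_eq_right)
qed (use assms in simp)

text \<open>The last coefficient decides that the polynomial has degree exactly
  \<open>s\<close>.\<close>

lemma hyp_coeff_nonzero:
  assumes "q \<noteq> 0" "z \<noteq> 0"
    and "\<And>k. k < s \<Longrightarrow> q ^ Suc k \<noteq> 1 \<and> d1 / q ^ k \<noteq> 1 \<and> d2 / q ^ k \<noteq> 1 \<and> m / q ^ k \<noteq> 1"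
  shows "hyp_coeff q s m d1 d2 z s \<noteq> 0"
proof -
  have "qpoch (q ^ s) (inverse q) s \<noteq> 0"
  proof (rule qpoch_nonzero)
    fix j assume "j < s"
    then obtain i where "s = Suc (i + j)" "i < s"
      by (metis less_imp_Suc_add add.commute add_Suc_right less_add_Suc1 less_add_Suc2)
    then show "inverse q ^ j * q ^ s \<noteq> 1"
      using assms(1) assms(3)[of i] by (simp add: power_add power_inverse field_simps)
  qed
  moreover have "qpoch (inverse q) (inverse q) s \<noteq> 0"
    using assms by (intro qpoch_nonzero) (auto simp: power_inverse field_simps)
  moreover have "qpoch d (inverse q) s \<noteq> 0" if "\<And>k. k < s \<Longrightarrow> d / q ^ k \<noteq> 1" for d
    using that by (intro qpoch_nonzero) (auto simp: power_inverse field_simps)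
  ultimately show ?thesis using assms by (simp add: hyp_coeff_def)
qed

text \<open>For nonzero \<open>u\<close> the variable part
  \<open>qpoch (a1 / u) (inverse q) k * u ^ k\<close> of a term is the Newton product with nodes
  \<open>a1 / q ^ j\<close>. At \<open>a1\<close> all terms but the first vanish, whence the
  normalization.\<close>

lemma ex_hyp_poly_newton:
  fixes q :: complex
  assumes nz: "q \<noteq> 0" "a1 \<noteq> 0" "a2 \<noteq> 0" "b1 \<noteq> 0" "b2 \<noteq> 0"
    and ab: "Q * b1 * b2 = q * a1 * a2" and Q: "Q = m * q ^ s"
    and roots: "\<And>k. k < s \<Longrightarrow> q ^ Suc k \<noteq> 1 \<and> a1 / b1 / q ^ k \<noteq> 1 \<and> a1 / b2 / q ^ k \<noteq> 1 \<and> m / q ^ k \<noteq> 1"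
  shows "\<exists>P. degree P = s \<and> poly P a1 = 1 \<and>
    (\<forall>u. u \<noteq> 0 \<longrightarrow> poly P u =
      phi32 (q ^ s) (a1 * inverse u) m (a1 / b1) (a1 / b2) (inverse q) (inverse (q * a2) * u)) \<and>
    (\<forall>u. qdiff q Q a1 a2 b1 b2 (poly P) u = - ((q ^ s - 1) * (m - 1)) * u\<^sup>2 * poly P u)"
proof -
  define c where "c = hyp_coeff q s m (a1 / b1) (a1 / b2) (inverse (q * a2))"
  define e where "e k = (\<Prod>j<k. [:- (a1 / q ^ j), 1:])" for k
  define P where "P = (\<Sum>k\<le>s. smult (c k) (e k))"
  have poly_e: "poly (e k) u = (\<Prod>j<k. u - a1 / q ^ j)" for k u
    by (simp add: e_def poly_prod)
  have poly_P: "poly P = (\<lambda>u. \<Sum>k\<le>s. c k * (\<Prod>j<k. u - a1 / q ^ j))"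
    by (simp add: P_def poly_sum poly_e fun_eq_iff)
  have "degree (e k) = k" for k
    unfolding e_def by (subst degree_prod_eq_sum_degree) auto
  moreover have "c s \<noteq> 0"
    unfolding c_def using nz roots by (intro hyp_coeff_nonzero) auto
  ultimately have "degree P = s"
    unfolding P_def by (intro degree_graded_sum) (auto simp: e_def)
  moreover have "poly P a1 = 1"
  proof -
    have "(\<Prod>j<Suc k. a1 - a1 / q ^ j) = 0" for k
      by (rule prod_zero) (auto intro!: bexI[of _ 0])
    then have "poly P a1 = c 0"
      unfolding poly_P by (subst sum.atMost_shift) (simp del: prod.lessThan_Suc prod_zero_iff)
    then show ?thesis by (simp add: c_def hyp_coeff_def)
  qed
  moreover have "poly P u =
      phi32 (q ^ s) (a1 * inverse u) m (a1 / b1) (a1 / b2) (inverse q) (inverse (q * a2) * u)"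
    if "u \<noteq> 0" for u
  proof -
    have "qpoch (a1 * inverse u) (inverse q) k * u ^ k = (\<Prod>j<k. u - a1 / q ^ j)" for k
      using that by (induction k) (simp_all add: qpoch_Suc power_inverse field_simps)
    then show ?thesis
      unfolding poly_P phi32_terminating[OF nz(1)] c_def by simp
  qed
  moreover have "qdiff q Q a1 a2 b1 b2 (poly P) u = - ((q ^ s - 1) * (m - 1)) * u\<^sup>2 * poly P u" for u
    unfolding poly_P c_def
    using nz Q roots qdiff_newton_basis[OF nz(1,2,4,5) ab] by (intro qdiff_hyp_sum) auto
  ultimately show ?thesis by blast
qed

text \<open>Here the variable enters only through \<open>qpoch (u / b1)\<close>, so the series is a
  polynomial as it stands and \<open>u = 0\<close> is included.\<close>

lemma ex_hyp_poly_qpoch: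
  fixes q :: complex
  assumes nz: "q \<noteq> 0" "b1 \<noteq> 0" "Q \<noteq> 0"
    and ab: "Q * b1 * b2 = q * a1 * a2" and Q: "Q = m * q ^ s"
    and roots: "\<And>k. k < s \<Longrightarrow> q ^ Suc k \<noteq> 1 \<and> a1 / b1 / q ^ k \<noteq> 1 \<and> a2 / b1 / q ^ k \<noteq> 1 \<and> m / q ^ k \<noteq> 1"
  shows "\<exists>P. degree P = s \<and> poly P b1 = 1 \<and>
    (\<forall>u. poly P u = phi32 (q ^ s) (u / b1) m (a1 / b1) (a2 / b1) (inverse q) (inverse q)) \<and>
    (\<forall>u. qdiff q Q a1 a2 b1 b2 (poly P) u = - ((q ^ s - 1) * (m - 1)) * u\<^sup>2 * poly P u)"
proof -
  define c where "c = hyp_coeff q s m (a1 / b1) (a2 / b1) (inverse (q * 1))"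
  define e where "e k = (\<Prod>j<k. [:1, - (inverse q ^ j / b1):])" for k
  define P where "P = (\<Sum>k\<le>s. smult (c k) (e k))"
  have poly_e: "poly (e k) u = qpoch (u / b1) (inverse q) k" for k u
    by (simp add: e_def poly_prod qpoch_def mult.commute)
  have poly_P: "poly P = (\<lambda>u. \<Sum>k\<le>s. c k * qpoch (u / b1) (inverse q) k)"
    by (simp add: P_def poly_sum poly_e fun_eq_iff)
  have "degree (e k) = k" for k
    unfolding e_def using nz by (subst degree_prod_eq_sum_degree) auto
  moreover have "c s \<noteq> 0"
    unfolding c_def using nz roots by (intro hyp_coeff_nonzero) auto
  ultimately have "degree P = s"
    unfolding P_def by (intro degree_graded_sum) (auto simp: e_def)
  moreover have "poly P b1 = 1"
  proof -
    have "poly P b1 = c 0"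
      unfolding poly_P using nz by (subst sum.atMost_shift) (simp add: qpoch_1)
    then show ?thesis by (simp add: c_def hyp_coeff_def)
  qed
  moreover have "poly P u = phi32 (q ^ s) (u / b1) m (a1 / b1) (a2 / b1) (inverse q) (inverse q)" for u
    using phi32_terminating[OF nz(1), of s "u / b1" m "a1 / b1" "a2 / b1" "inverse q" 1]
    unfolding poly_P c_def by simp
  moreover have "qdiff q Q a1 a2 b1 b2 (poly P) u = - ((q ^ s - 1) * (m - 1)) * u\<^sup>2 * poly P u" for u
    unfolding poly_P c_def
    using nz Q roots qdiff_qpoch_basis[OF nz ab] by (intro qdiff_hyp_sum) auto
  ultimately show ?thesis by blast
qed

section \<open>Uniqueness for the recurrence and interpolation\<close>

lemma three_term_zero:
  fixes z :: "nat \<Rightarrow> complex"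
  assumes rec: "\<And>t. t0 \<le> t \<Longrightarrow> t \<le> t1 \<Longrightarrow>
      A t * (z (Suc t) - z t) + B t * (z (t - 1) - z t) = C t * z t"
    and "B t0 = 0" "\<And>t. t0 \<le> t \<Longrightarrow> t < t1 \<Longrightarrow> A t \<noteq> 0" and "z t0 = 0"
    and "t0 \<le> t" "t \<le> t1"
  shows "z t = 0"
  using \<open>t0 \<le> t\<close> \<open>t \<le> t1\<close>
proof (induction t rule: less_induct)
  case (less t)
  show ?case
  proof (cases "t = t0")
    case False
    with less obtain u where u: "t = Suc u" "t0 \<le> u" by (cases t) auto
    then have "z u = 0" using less by auto
    moreover have "B u * z (u - 1) = 0"
      using assms(2) less u by (cases "u = t0") auto
    ultimately have "A u * z t = 0" using rec[of u] less u by auto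
    then show ?thesis using assms(3)[of u] less u by simp
  qed (use assms in simp)
qed

lemma II_eq: "r2 \<le> n \<Longrightarrow> r1 \<le> n \<Longrightarrow> II n r1 r2 = {r2 - r1..min r2 (n - r1)}"
  by (auto simp: II_def)

lemma card_II: "r2 \<le> n \<Longrightarrow> r1 \<le> n \<Longrightarrow> card (II n r1 r2) = Suc (NN n r1 r2)"
  by (auto simp: II_eq NN_def min_def)

text \<open>As \<open>norm q > 1\<close>, the interpolation points are distinct, and by
  \<open>card_II\<close> there is one more of them than the degree bound.\<close>

lemma poly_eqI_on_II:
  fixes f g :: "complex poly" and q :: complex
  assumes q: "norm q > 1" and r: "r1 \<le> n" "r2 \<le> n"
    and deg: "degree f \<le> NN n r1 r2" "degree g \<le> NN n r1 r2"
    and eq: "\<And>t. t \<in> II n r1 r2 \<Longrightarrow> poly f (q powi (- int t)) = poly g (q powi (- int t))"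
  shows "f = g"
proof (rule poly_eqI_degree)
  let ?A = "(\<lambda>t. q powi (- int t)) ` II n r1 r2"
  have "t = t'" if "q powi (- int t) = q powi (- int t')" for t t'
  proof -
    have "norm q ^ t = norm q ^ t'"
      using arg_cong[OF that, of norm] by (simp add: power_int_minus norm_inverse norm_power)
    then show ?thesis using q by simp
  qed
  then have "inj_on (\<lambda>t. q powi (- int t)) (II n r1 r2)"
    by (rule inj_onI)
  then have "card ?A = Suc (NN n r1 r2)" using r by (simp add: card_image card_II)
  then show "card ?A > degree f" "card ?A > degree g" using deg by simp_all
qed (use eq in auto)

text \<open>Both \<kappa> and the values of \<open>P\<close> solve the recurrence, and a solution is
  determined by its value at the first index, so the two are proportional.\<close>

lemma interpolant_eq_multiple:
  fixes q :: complex
  assumes q: "norm q > 1" and r: "r1 \<le> n" "r2 \<le> n" and s: "degree P \<le> NN n r1 r2"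
    and P: "P \<noteq> 0"
    and qdiff_P: "\<And>u. qdiff q (q ^ Suc n) 1 (q powi (int r1 - int r2)) (q powi (- int r2)) (q powi (int r1 - int n))
        (poly P) u = C * u\<^sup>2 * poly P u"
    and rec: "\<And>t u. t \<in> II n r1 r2 \<Longrightarrow> u = q powi (- int t) \<Longrightarrow>
       q ^ Suc n * (u - q powi (- int r2)) * (u - q powi (int r1 - int n)) * (\<kappa> (Suc t) - \<kappa> t) +
       (u - 1) * (u - q powi (int r1 - int r2)) * (\<kappa> (t - 1) - \<kappa> t) = C * u\<^sup>2 * \<kappa> t"
  shows "\<exists>c. \<forall>t\<in>II n r1 r2. \<kappa> t = poly (smult c P) (q powi (- int t))"
proof -
  define t0 where "t0 = r2 - r1"
  define t1 where "t1 = min r2 (n - r1)"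
  have II: "t \<in> II n r1 r2 \<longleftrightarrow> t0 \<le> t \<and> t \<le> t1" for t
    using r by (simp add: II_eq t0_def t1_def)
  have "t0 \<le> t1" using r by (auto simp: t0_def t1_def)
  define v where "v t = q powi (- int t)" for t
  define y where "y t = poly P (v t)" for t
  define A where "A t = q ^ Suc n * (v t - q powi (- int r2)) * (v t - q powi (int r1 - int n))" for t
  define B where "B t = (v t - 1) * (v t - q powi (int r1 - int r2))" for t
  have q0: "q \<noteq> 0" using q by auto
  have powi_inj: "q powi i = q powi j \<longleftrightarrow> i = j" for i j
  proof
    assume "q powi i = q powi j"
    then have "norm q powi i = norm q powi j" by (metis norm_power_int)
    then show "i = j"
      using q power_int_strict_increasing[of i j "norm q"] power_int_strict_increasing[of j i "norm q"]
      by (cases i j rule: linorder_cases) auto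
  qed simp
  \<comment> \<open>The first index is the larger of 0 and \<open>r2 - r1\<close>; which factor of
    \<open>B\<close> vanishes depends on which of the two it is.\<close>
  have B0: "B t0 = 0"
  proof (cases "r2 \<le> r1")
    case True
    then show ?thesis by (simp add: B_def v_def t0_def)
  next
    case False
    then have "- int t0 = int r1 - int r2" by (simp add: t0_def)
    then show ?thesis by (simp add: B_def v_def)
  qed
  \<comment> \<open>The zeros of \<open>A\<close> are at \<open>t = r2\<close> and
    \<open>t = n - r1\<close>, and \<open>t1\<close> is the smaller of these.\<close>
  have A: "A t \<noteq> 0" if "t0 \<le> t" "t < t1" for t
    using that r q0 unfolding A_def v_def by (auto simp: powi_inj t1_def)
  have rec_x: "A t * (\<kappa> (Suc t) - \<kappa> t) + B t * (\<kappa> (t - 1) - \<kappa> t) = C * (v t)\<^sup>2 * \<kappa> t"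
    if "t0 \<le> t" "t \<le> t1" for t
    using rec[of t "v t"] that by (simp add: II A_def B_def v_def)
  have rec_y: "A t * (y (Suc t) - y t) + B t * (y (t - 1) - y t) = C * (v t)\<^sup>2 * y t" for t
  proof -
    have v_eq: "v t = inverse (q ^ t)" for t by (simp add: v_def power_int_minus)
    have 1: "v (Suc t) = v t / q"
      using q0 by (simp add: v_eq field_simps)
    have "q * v t = v (t - 1)" if "t > 0"
      using q0 that by (cases t) (simp_all add: v_eq field_simps)
    moreover have "B t = 0" if "t = 0" using that by (simp add: B_def v_def)
    \<comment> \<open>At \<open>t = 0\<close> the truncated \<open>t - 1\<close> does not correspond
      to \<open>q * v t\<close>, but \<open>B\<close> vanishes there.\<close>
    ultimately have 2: "B t * (y (t - 1) - y t) = B t * (poly P (q * v t) - y t)"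
      by (cases "t = 0") (simp_all add: y_def)
    show ?thesis
      using qdiff_P[of "v t"] unfolding 2 by (simp add: qdiff_def 1 A_def B_def y_def)
  qed
  \<comment> \<open>Otherwise all values of \<open>P\<close> on \<open>II\<close> would be 0, more
    zeros than its degree permits.\<close>
  have "y t0 \<noteq> 0"
  proof
    assume "y t0 = 0"
    then have "y t = 0" if "t0 \<le> t" "t \<le> t1" for t
      using three_term_zero[of t0 t1 A y B "\<lambda>t. C * (v t)\<^sup>2" t] rec_y B0 A that by blast
    then have "P = 0"
      using s by (intro poly_eqI_on_II[OF q r]) (auto simp: II y_def v_def)
    with P show False ..
  qed
  define c where "c = \<kappa> t0 / y t0"
  define z where "z t = \<kappa> t - c * y t" for t
  have "z t = 0" if "t0 \<le> t" "t \<le> t1" for t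
  proof (rule three_term_zero[where A = A and B = B and C = "\<lambda>t. C * (v t)\<^sup>2" and z = z and ?t0.0 = t0 and ?t1.0 = t1, OF _ B0 A])
    show "A t * (z (Suc t) - z t) + B t * (z (t - 1) - z t) = (C * (v t)\<^sup>2) * z t"
      if "t0 \<le> t" "t \<le> t1" for t
    proof -
      have "A t * (z (Suc t) - z t) + B t * (z (t - 1) - z t) =
          (A t * (\<kappa> (Suc t) - \<kappa> t) + B t * (\<kappa> (t - 1) - \<kappa> t))
          - c * (A t * (y (Suc t) - y t) + B t * (y (t - 1) - y t))"
        by (simp add: z_def algebra_simps)
      then show ?thesis unfolding rec_x[OF that] rec_y by (simp add: z_def algebra_simps)
    qed
    show "z t0 = 0" using \<open>y t0 \<noteq> 0\<close> by (simp add: z_def c_def)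
  qed (use that in auto)
  then have "\<forall>t\<in>II n r1 r2. \<kappa> t = poly (smult c P) (q powi (- int t))"
    by (auto simp: II z_def y_def v_def)
  then show ?thesis ..
qed

text \<open>The roots 1, \<open>b\<close>, \<open>d\<close> and \<open>a\<close> of the coefficients
  serve in turn as base point of a polynomial solution with value 1 there. The interpolant is a
  multiple of each solution, the factor being its value at that base point.\<close>

theorem hypergeometric_interpolant:
  fixes q :: complex
  assumes q: "norm q > 1" and r: "r1 \<le> n" "r2 \<le> n" and s: "s \<le> NN n r1 r2"
    and nonzero: "\<exists>t\<in>II n r1 r2. \<kappa> t \<noteq> 0"
    and rec: "\<And>t u. t \<in> II n r1 r2 \<Longrightarrow> u = q powi (- int t) \<Longrightarrow>
       q ^ Suc n * (u - q powi (- int r2)) * (u - q powi (int r1 - int n)) * (\<kappa> (Suc t) - \<kappa> t) +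
       (u - 1) * (u - q powi (int r1 - int r2)) * (\<kappa> (t - 1) - \<kappa> t) =
       - ((q ^ s - 1) * (q ^ (n - s + 1) - 1)) * u\<^sup>2 * \<kappa> t"
  shows "(\<exists>!f. degree f \<le> NN n r1 r2 \<and> (\<forall>t\<in>II n r1 r2. poly f (q powi (- int t)) = \<kappa> t)) \<and>
        (\<forall>f. degree f \<le> NN n r1 r2 \<and> (\<forall>t\<in>II n r1 r2. poly f (q powi (- int t)) = \<kappa> t) \<longrightarrow>
           f \<noteq> 0 \<and> degree f = s \<and>
           (\<forall>u. u \<noteq> 0 \<longrightarrow>
              poly f u = poly f 1 *
                phi32 (q ^ s) (inverse u) (q ^ (n - s + 1)) (q ^ (n - r1)) (q ^ r2)
                  (inverse q) (q powi (int r2 - int r1 - 1) * u)) \<and>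
           (\<forall>u.
              poly f u = poly f (q powi (- int r2)) *
                phi32 (q ^ s) (q ^ r2 * u) (q ^ (n - s + 1)) (q ^ r1) (q ^ r2)
                  (inverse q) (inverse q)) \<and>
           (\<forall>u.
              poly f u = poly f (q powi (int r1 - int n)) *
                phi32 (q ^ s) (q ^ (n - r1) * u) (q ^ (n - s + 1)) (q ^ (n - r1)) (q ^ (n - r2))
                  (inverse q) (inverse q)) \<and>
           (\<forall>u. u \<noteq> 0 \<longrightarrow>
              poly f u = poly f (q powi (int r1 - int r2)) *
                phi32 (q ^ s) (q powi (int r1 - int r2) * inverse u) (q ^ (n - s + 1))
                  (q ^ r1) (q ^ (n - r2))
                  (inverse q) (inverse q * u)))"
    (is "?ex \<and> (\<forall>f. ?interpolant f \<longrightarrow> ?formulas f)")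
proof -
  have q0: "q \<noteq> 0" using q by auto
  define a where "a = q powi (int r1 - int r2)"
  define b where "b = q powi (- int r2)"
  define d where "d = q powi (int r1 - int n)"
  define m where "m = q ^ (n - s + 1)"
  note defs = a_def b_def d_def
  have nz: "a \<noteq> 0" "b \<noteq> 0" "d \<noteq> 0" using q0 by (simp_all add: defs)
  have s_le: "s \<le> r1" "s \<le> r2" "s \<le> n - r1" "s \<le> n - r2" using s by (simp_all add: NN_def)
  then have "n = (n - s) + s" using r by simp
  then have Q: "q ^ Suc n = m * q ^ s"
    unfolding m_def by (metis add.commute add_Suc_right power_add Suc_eq_plus1)
  have ab: "q ^ Suc n * b * d = q * 1 * a"
    using q0 r by (simp add: defs power_int_diff power_int_minus field_simps)
  have quot: "1 / b = q ^ r2" "1 / d = q ^ (n - r1)" "a / b = q ^ r1" "a / d = q ^ (n - r2)"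
    using q0 r by (simp_all add: defs power_int_diff power_int_minus power_diff field_simps)
  have pow_ne_1: "q ^ k \<noteq> 1" if "k > 0" for k
  proof
    assume "q ^ k = 1"
    then have "norm q ^ k = 1" by (metis norm_power norm_one)
    then show False using q that by (metis one_less_power order_less_irrefl)
  qed
  have pow_quot: "q ^ j / q ^ k \<noteq> 1" if "k < j" for j k
    using pow_ne_1[of "j - k"] that q0 by (simp add: power_diff)
  have roots: "q ^ Suc k \<noteq> 1 \<and> q ^ r1 / q ^ k \<noteq> 1 \<and> q ^ r2 / q ^ k \<noteq> 1 \<and>
      q ^ (n - r1) / q ^ k \<noteq> 1 \<and> q ^ (n - r2) / q ^ k \<noteq> 1 \<and> m / q ^ k \<noteq> 1" if "k < s" for k
    unfolding m_def using that s_le r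
    by (intro conjI pow_ne_1 pow_quot) simp_all
  have rec': "\<And>t u. t \<in> II n r1 r2 \<Longrightarrow> u = q powi (- int t) \<Longrightarrow>
       q ^ Suc n * (u - q powi (- int r2)) * (u - q powi (int r1 - int n)) * (\<kappa> (Suc t) - \<kappa> t) +
       (u - 1) * (u - q powi (int r1 - int r2)) * (\<kappa> (t - 1) - \<kappa> t) =
       - ((q ^ s - 1) * (m - 1)) * u\<^sup>2 * \<kappa> t"
    unfolding m_def by (rule rec)
  have mult: "\<exists>c. c \<noteq> 0 \<and> (\<forall>t\<in>II n r1 r2. \<kappa> t = poly (smult c P) (q powi (- int t)))"
    if deg: "degree P = s" and base: "poly P x = 1"
      and P: "\<forall>u. qdiff q (q ^ Suc n) 1 a b d (poly P) u = - ((q ^ s - 1) * (m - 1)) * u\<^sup>2 * poly P u"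
    for P x
  proof -
    have "\<exists>c. \<forall>t\<in>II n r1 r2. \<kappa> t = poly (smult c P) (q powi (- int t))"
    proof (rule interpolant_eq_multiple[OF q r _ _ _ rec'])
      show "P \<noteq> 0" using base by auto
      show "degree P \<le> NN n r1 r2" using deg s by simp
    qed (use P in \<open>simp_all add: defs\<close>)
    moreover have "c \<noteq> 0" if "\<forall>t\<in>II n r1 r2. \<kappa> t = poly (smult c P) (q powi (- int t))" for c
      using that nonzero by auto
    ultimately show ?thesis by blast
  qed
  have solution: "f = smult (poly f x) P \<and> poly f x \<noteq> 0"
    if f: "degree f \<le> NN n r1 r2" "\<forall>t\<in>II n r1 r2. poly f (q powi (- int t)) = \<kappa> t"
      and P: "degree P = s" "poly P x = 1"
        "\<forall>u. qdiff q (q ^ Suc n) 1 a b d (poly P) u = - ((q ^ s - 1) * (m - 1)) * u\<^sup>2 * poly P u"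
    for f P x
  proof -
    obtain c where c: "c \<noteq> 0" "\<forall>t\<in>II n r1 r2. \<kappa> t = poly (smult c P) (q powi (- int t))"
      using mult[OF P] by blast
    have "f = smult c P"
      using f c P s by (intro poly_eqI_on_II[OF q r]) auto
    then show ?thesis using c P by simp
  qed
  have Q0: "q ^ Suc n \<noteq> 0" using q0 by simp
  \<comment> \<open>The roots \<open>d\<close> and \<open>b\<close> are passed in this order so that
    the lower parameters \<open>q ^ (n - r1)\<close> and \<open>q ^ r2\<close> appear in the stated
    order.\<close>
  obtain P1 where P1: "degree P1 = s" "poly P1 1 = 1"
      "\<forall>u. u \<noteq> 0 \<longrightarrow> poly P1 u = phi32 (q ^ s) (1 * inverse u) m (1 / d) (1 / b) (inverse q) (inverse (q * a) * u)"
      "\<forall>u. qdiff q (q ^ Suc n) 1 a b d (poly P1) u = - ((q ^ s - 1) * (m - 1)) * u\<^sup>2 * poly P1 u"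
    using ex_hyp_poly_newton[of q 1 a d b "q ^ Suc n" m s] q0 nz ab Q roots
    by (auto simp: quot qdiff_swap(2)[of _ _ _ _ d b] mult_ac)
  obtain P2 where P2: "degree P2 = s" "poly P2 b = 1"
      "\<forall>u. poly P2 u = phi32 (q ^ s) (u / b) m (a / b) (1 / b) (inverse q) (inverse q)"
      "\<forall>u. qdiff q (q ^ Suc n) 1 a b d (poly P2) u = - ((q ^ s - 1) * (m - 1)) * u\<^sup>2 * poly P2 u"
    using ex_hyp_poly_qpoch[of q b "q ^ Suc n" d a 1 m s] q0 nz ab Q roots
    by (auto simp: quot qdiff_swap(1)[of _ _ a 1] mult_ac)
  obtain P3 where P3: "degree P3 = s" "poly P3 d = 1"
      "\<forall>u. poly P3 u = phi32 (q ^ s) (u / d) m (1 / d) (a / d) (inverse q) (inverse q)"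
      "\<forall>u. qdiff q (q ^ Suc n) 1 a b d (poly P3) u = - ((q ^ s - 1) * (m - 1)) * u\<^sup>2 * poly P3 u"
    using ex_hyp_poly_qpoch[of q d "q ^ Suc n" b 1 a m s] q0 nz ab Q roots
    by (auto simp: quot qdiff_swap(2)[of _ _ _ _ d b] mult_ac)
  obtain P4 where P4: "degree P4 = s" "poly P4 a = 1"
      "\<forall>u. u \<noteq> 0 \<longrightarrow> poly P4 u = phi32 (q ^ s) (a * inverse u) m (a / b) (a / d) (inverse q) (inverse (q * 1) * u)"
      "\<forall>u. qdiff q (q ^ Suc n) 1 a b d (poly P4) u = - ((q ^ s - 1) * (m - 1)) * u\<^sup>2 * poly P4 u"
    using ex_hyp_poly_newton[of q a 1 b d "q ^ Suc n" m s] q0 nz ab Q roots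
    by (auto simp: quot qdiff_swap(1)[of _ _ a 1] mult_ac)
  have ex: ?ex
  proof (rule ex_ex1I)
    show "\<exists>f. degree f \<le> NN n r1 r2 \<and> (\<forall>t\<in>II n r1 r2. poly f (q powi (- int t)) = \<kappa> t)"
      using mult[OF P1(1,2,4)] P1(1) s by (metis degree_smult_eq)
    show "f = g"
      if "degree f \<le> NN n r1 r2 \<and> (\<forall>t\<in>II n r1 r2. poly f (q powi (- int t)) = \<kappa> t)"
         "degree g \<le> NN n r1 r2 \<and> (\<forall>t\<in>II n r1 r2. poly g (q powi (- int t)) = \<kappa> t)" for f g
      using that by (intro poly_eqI_on_II[OF q r]) auto
  qed
  have z: "inverse (q * a) = q powi (int r2 - int r1 - 1)"
    using q0 by (simp add: a_def power_int_diff power_int_add field_simps)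
  have div: "u / b = q ^ r2 * u" "u / d = q ^ (n - r1) * u" for u
    by (simp_all flip: quot(1,2))
  have "?formulas f" if f: "degree f \<le> NN n r1 r2" "\<forall>t\<in>II n r1 r2. poly f (q powi (- int t)) = \<kappa> t" for f
  proof -
    note sol1 = solution[OF f P1(1,2,4)] and sol2 = solution[OF f P2(1,2,4)]
      and sol3 = solution[OF f P3(1,2,4)] and sol4 = solution[OF f P4(1,2,4)]
    show ?thesis
    proof (intro conjI allI impI)
      show "f \<noteq> 0" using sol1 by auto
      show "degree f = s" using sol1 P1(1) by (metis degree_smult_eq)
      show "poly f u = poly f 1 * phi32 (q ^ s) (inverse u) (q ^ (n - s + 1)) (q ^ (n - r1)) (q ^ r2)
                    (inverse q) (q powi (int r2 - int r1 - 1) * u)" if "u \<noteq> 0" for u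
        using arg_cong[OF conjunct1[OF sol1], of "\<lambda>f. poly f u"] P1(3) that
        by (simp add: quot m_def flip: z)
      show "poly f u = poly f (q powi (- int r2)) *
                  phi32 (q ^ s) (q ^ r2 * u) (q ^ (n - s + 1)) (q ^ r1) (q ^ r2)
                    (inverse q) (inverse q)" for u
        using arg_cong[OF conjunct1[OF sol2], of "\<lambda>f. poly f u"] P2(3)[unfolded quot, unfolded div]
        by (simp add: m_def flip: b_def)
      show "poly f u = poly f (q powi (int r1 - int n)) *
                  phi32 (q ^ s) (q ^ (n - r1) * u) (q ^ (n - s + 1)) (q ^ (n - r1)) (q ^ (n - r2))
                    (inverse q) (inverse q)" for u
        using arg_cong[OF conjunct1[OF sol3], of "\<lambda>f. poly f u"] P3(3)[unfolded quot, unfolded div]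
        by (simp add: m_def flip: d_def)
      show "poly f u = poly f (q powi (int r1 - int r2)) *
                  phi32 (q ^ s) (q powi (int r1 - int r2) * inverse u) (q ^ (n - s + 1))
                    (q ^ r1) (q ^ (n - r2))
                    (inverse q) (inverse q * u)" if "u \<noteq> 0" for u
        using arg_cong[OF conjunct1[OF sol4], of "\<lambda>f. poly f u"] P4(3) that
        by (simp add: quot m_def flip: a_def)
    qed
  qed
  with ex show ?thesis by blast
qed

section \<open>The kernels of equivariant maps\<close>

context decomposed_grassmannians begin

lemma kernel_nonzero:
  assumes r: "r1 \<le> n" "r2 \<le> n" and s: "s \<le> NN n r1 r2"
    and \<Lambda>: "extended_equivariant scale r1 (W r1 s) r2 (W r2 s) \<Lambda>"
    and \<kappa>: "is_kernel scale r1 r2 \<Lambda> \<kappa>"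
  shows "\<exists>t\<in>II n r1 r2. \<kappa> t \<noteq> 0"
proof (rule ccontr)
  assume "\<not> ?thesis"
  then have zero: "\<kappa> (gdist scale y x) = 0" if "y \<in> Gr scale r2" "x \<in> Gr scale r1" for y x
    using gdist_in_II[OF that] by blast
  obtain \<phi> where \<phi>: "\<phi> \<in> W r1 s" "\<Lambda> \<phi> \<noteq> 0" using \<Lambda> by (auto simp: extended_equivariant_def)
  have "\<phi> \<in> VV scale r1" using \<phi> W_VV[OF r(1), of s] s by (auto simp: NN_def)
  moreover from this have "\<Lambda> \<phi> \<in> VV scale r2"
    using \<Lambda> by (simp add: extended_equivariant_def lin_map_def)
  ultimately have "\<Lambda> \<phi> y = 0" for y
    using \<kappa> zero by (cases "y \<in> Gr scale r2") (simp_all add: is_kernel_def VV_def)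
  then show False using \<phi> by (simp add: fun_eq_iff)
qed

context
  fixes q :: complex assumes q: "q = of_nat CARD('k)"
begin

lemma mu_eq: "mu q s n = of_nat (qnum CARD('k) s * qnum CARD('k) (Suc (n - s)))"
  by (simp add: mu_def q of_nat_qnum[OF q_ge_2] power2_eq_square)

lemma norm_q: "norm q > 1"
  using q_ge_2 by (simp add: q)

text \<open>On \<open>Gr scale r2\<close> this function of \<open>w\<close> is the image under
  \<Lambda> of the point mass at \<open>x\<close>, which lies in \<open>W r2 s\<close> and is an
  eigenfunction by \<open>laplacian_W\<close>.\<close>

lemma laplacian_kernel:
  assumes r: "r1 \<le> n" "r2 \<le> n" and s: "s \<le> NN n r1 r2"
    and \<Lambda>: "extended_equivariant scale r1 (W r1 s) r2 (W r2 s) \<Lambda>"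
    and \<kappa>: "is_kernel scale r1 r2 \<Lambda> \<kappa>"
    and x: "x \<in> Gr scale r1" and y: "y \<in> Gr scale r2"
  shows "laplacian scale r2 (\<lambda>w. \<kappa> (gdist scale w x)) y = - mu q s n * \<kappa> (gdist scale y x)"
proof -
  define \<delta> :: "'v set \<Rightarrow> complex" where "\<delta> z = (if z = x then 1 else 0)" for z
  have \<delta>: "\<delta> \<in> VV scale r1" using x by (auto simp: VV_def \<delta>_def)
  have \<Lambda>\<delta>: "\<Lambda> \<delta> w = \<kappa> (gdist scale w x)" if "w \<in> Gr scale r2" for w
  proof -
    have "\<Lambda> \<delta> w = (\<Sum>z\<in>Gr scale r1. \<kappa> (gdist scale w z) * \<delta> z)"
      using \<kappa> \<delta> that by (simp add: is_kernel_def)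
    also have "\<dots> = (\<Sum>z\<in>Gr scale r1. if z = x then \<kappa> (gdist scale w z) else 0)"
      by (intro sum.cong) (auto simp: \<delta>_def)
    finally show ?thesis using x by simp
  qed
  have s2: "s \<le> min r2 (n - r2)" using s by (simp add: NN_def)
  have "laplacian scale r2 (\<Lambda> \<delta>) y = - mu q s n * \<Lambda> \<delta> y"
    using laplacian_W[OF r(2) s2 extended_equivariant_image[OF r s \<Lambda> \<delta>]]
    by (simp add: mu_eq cscale_def)
  moreover have "laplacian scale r2 (\<Lambda> \<delta>) y = laplacian scale r2 (\<lambda>w. \<kappa> (gdist scale w x)) y"
    using y by (simp add: laplacian_def \<Lambda>\<delta>)
  ultimately show ?thesis using \<Lambda>\<delta> y by simp
qed

text \<open>This is \<open>laplacian_radial\<close> at a pair at distance \<open>t\<close>,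
  multiplied by \<open>(q - 1)\<^sup>2 * u\<^sup>2\<close>. One factor \<open>u\<close> goes to each
  q-number difference, which thereby becomes linear in \<open>u\<close>.\<close>

lemma kernel_recurrence:
  assumes r: "r1 \<le> n" "r2 \<le> n" and s: "s \<le> NN n r1 r2"
    and \<Lambda>: "extended_equivariant scale r1 (W r1 s) r2 (W r2 s) \<Lambda>"
    and \<kappa>: "is_kernel scale r1 r2 \<Lambda> \<kappa>"
    and t: "t \<in> II n r1 r2" and u: "u = q powi (- int t)"
  shows "q ^ Suc n * (u - q powi (- int r2)) * (u - q powi (int r1 - int n)) * (\<kappa> (Suc t) - \<kappa> t) +
       (u - 1) * (u - q powi (int r1 - int r2)) * (\<kappa> (t - 1) - \<kappa> t) =
       - ((q ^ s - 1) * (q ^ (n - s + 1) - 1)) * u\<^sup>2 * \<kappa> t"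
proof -
  obtain y x where y: "y \<in> Gr scale r2" and x: "x \<in> Gr scale r1" and yx: "gdist scale y x = t"
    using ex_gdist[OF t] .
  obtain d where d: "dim (y \<inter> x) = d" "gdist scale y x = r2 - d" "d \<le> r2" "d \<le> r1" "r1 + r2 \<le> n + d"
    using gdist_cases[OF y x] .
  have td: "t = r2 - d" using d yx by simp
  define A where "A = \<kappa> (t - 1) - \<kappa> t"
  define B where "B = \<kappa> (Suc t) - \<kappa> t"
  define e where "e = r1 - d"
  define Q where "Q k = (of_nat (qnum CARD('k) k) :: complex)" for k
  have "Q t * Q e * A + (Q r2 - Q t) * (Q (Suc (n - r2)) - Q (Suc e)) * B = - mu q s n * \<kappa> t"
    using laplacian_kernel[OF r s \<Lambda> \<kappa> x y] laplacian_radial[OF y x d(1), of \<kappa>]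
    unfolding yx td[symmetric] A_def B_def e_def Q_def by simp
  moreover have Q: "Q k = (q ^ k - 1) / (q - 1)" for k
    unfolding Q_def q by (rule of_nat_qnum[OF q_ge_2])
  have "q - 1 \<noteq> 0" using norm_q by auto
  moreover have "mu q s n = (q ^ s - 1) * (q ^ (n - s + 1) - 1) / (q - 1)\<^sup>2"
    by (simp add: mu_def)
  ultimately have main: "(q ^ t - 1) * (q ^ e - 1) * A +
      (q ^ r2 - q ^ t) * (q ^ Suc (n - r2) - q ^ Suc e) * B =
      - ((q ^ s - 1) * (q ^ (n - s + 1) - 1)) * \<kappa> t"
    unfolding Q by (simp add: divide_simps power2_eq_square)
  have q0: "q \<noteq> 0" using norm_q by auto
  have u': "u * q ^ t = 1" using u q0 by (simp add: power_int_minus)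
  \<comment> \<open>Since \<open>e - t = r1 - r2\<close>, multiplication by \<open>u\<close>
    eliminates the dimension \<open>d\<close> of the meet.\<close>
  have 1: "u * q ^ e = q powi (int r1 - int r2)"
  proof -
    have "int r1 - int r2 = - int t + int e" using td e_def d by simp
    then have "q powi (int r1 - int r2) = q powi (- int t) * q powi int e"
      using q0 by (simp only: power_int_add simp_thms)
    then show ?thesis using u by simp
  qed
  have 2: "u * (q ^ r2 - q ^ t) = q ^ r2 * (u - q powi (- int r2))"
    using u' q0 by (simp add: power_int_minus right_diff_distrib mult.commute)
  have 3: "u * (q ^ Suc (n - r2) - q ^ Suc e) = q ^ Suc (n - r2) * (u - q powi (int r1 - int n))"
  proof -
    have "q ^ Suc (n - r2) * q powi (int r1 - int n) = q powi (int (Suc (n - r2)) + (int r1 - int n))"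
      using q0 by (simp only: power_int_add power_int_of_nat simp_thms)
    also have "int (Suc (n - r2)) + (int r1 - int n) = 1 + (int r1 - int r2)" using r by simp
    also have "q powi \<dots> = q * q powi (int r1 - int r2)" 
      using q0 by (simp only: power_int_add power_int_1_right simp_thms)
    finally show ?thesis using 1 by (auto simp: right_diff_distrib mult_ac)
  qed
  have 4: "q ^ Suc n = q ^ r2 * q ^ Suc (n - r2)" using r by (simp flip: power_add)
  have "u\<^sup>2 * ((q ^ t - 1) * (q ^ e - 1) * A) = (u * q ^ t - u) * (u * q ^ e - u) * A"
    by (simp add: power2_eq_square algebra_simps)
  also have "\<dots> = (u - 1) * (u - q powi (int r1 - int r2)) * A"
    unfolding u' 1 by (simp add: algebra_simps)
  finally have 5: "u\<^sup>2 * ((q ^ t - 1) * (q ^ e - 1) * A) = \<dots>" .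
  have "u\<^sup>2 * ((q ^ r2 - q ^ t) * (q ^ Suc (n - r2) - q ^ Suc e) * B) =
      (u * (q ^ r2 - q ^ t)) * (u * (q ^ Suc (n - r2) - q ^ Suc e)) * B"
    by (simp only: power2_eq_square mult_ac)
  also have "\<dots> = q ^ Suc n * (u - q powi (- int r2)) * (u - q powi (int r1 - int n)) * B"
    unfolding 2 3 4 by (simp only: mult_ac)
  finally show ?thesis
    using 5 arg_cong[OF main, of "\<lambda>z. u\<^sup>2 * z"] unfolding A_def B_def distrib_left
    by (simp only: mult_ac add.commute)
qed

end

end

theorem theorem3p6:
  fixes smul :: "'k::{field,finite} \<Rightarrow> 'v::ab_group_add \<Rightarrow> 'v"
    and Basis :: "'v set"
    and n :: nat
    and q :: complex
    and U :: "nat \<Rightarrow> ('i \<Rightarrow> complex) set"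
    and \<pi> :: "nat \<Rightarrow> ('v \<Rightarrow> 'v) \<Rightarrow> ('i \<Rightarrow> complex) \<Rightarrow> ('i \<Rightarrow> complex)"
    and W :: "nat \<Rightarrow> nat \<Rightarrow> ('v set \<Rightarrow> complex) set"
  assumes "finite_dimensional_vector_space smul Basis"
    and "vector_space.dim smul (UNIV :: 'v set) = n"
    and "q = of_nat CARD('k)"
    and "grassmann_decomposition smul n U \<pi> W"
  shows
    "(\<forall>r s \<phi>. r \<le> n \<and> s \<le> min r (n - r) \<and> \<phi> \<in> W r s \<longrightarrow>
        laplacian smul r \<phi> = cscale (- mu q s n) \<phi>)
     \<and>
     (\<forall>r1 r2 s \<Lambda>. r1 \<le> n \<and> r2 \<le> n \<and> s \<le> NN n r1 r2 \<and>
        extended_equivariant smul r1 (W r1 s) r2 (W r2 s) \<Lambda> \<longrightarrow>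
        (\<forall>\<phi>\<in>VV smul r1. laplacian_op smul r2 \<Lambda> \<phi> + cscale (mu q s n) (\<Lambda> \<phi>) = 0))
     \<and>
     (\<forall>r1 r2 s \<Lambda> \<kappa>. r1 \<le> n \<and> r2 \<le> n \<and> s \<le> NN n r1 r2 \<and>
        extended_equivariant smul r1 (W r1 s) r2 (W r2 s) \<Lambda> \<and>
        is_kernel smul r1 r2 \<Lambda> \<kappa> \<longrightarrow>
        (\<exists>!f :: complex poly.
           degree f \<le> NN n r1 r2 \<and> (\<forall>t\<in>II n r1 r2. poly f (q powi (- int t)) = \<kappa> t)) \<and>
        (\<forall>f :: complex poly.
           degree f \<le> NN n r1 r2 \<and> (\<forall>t\<in>II n r1 r2. poly f (q powi (- int t)) = \<kappa> t) \<longrightarrow>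
           f \<noteq> 0 \<and> degree f = s \<and>
           (\<forall>u. u \<noteq> 0 \<longrightarrow>
              poly f u = poly f 1 *
                phi32 (q ^ s) (inverse u) (q ^ (n - s + 1)) (q ^ (n - r1)) (q ^ r2)
                  (inverse q) (q powi (int r2 - int r1 - 1) * u)) \<and>
           (\<forall>u.
              poly f u = poly f (q powi (- int r2)) *
                phi32 (q ^ s) (q ^ r2 * u) (q ^ (n - s + 1)) (q ^ r1) (q ^ r2)
                  (inverse q) (inverse q)) \<and>
           (\<forall>u.
              poly f u = poly f (q powi (int r1 - int n)) *
                phi32 (q ^ s) (q ^ (n - r1) * u) (q ^ (n - s + 1)) (q ^ (n - r1)) (q ^ (n - r2))
                  (inverse q) (inverse q)) \<and>
           (\<forall>u. u \<noteq> 0 \<longrightarrow>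
              poly f u = poly f (q powi (int r1 - int r2)) *
                phi32 (q ^ s) (q powi (int r1 - int r2) * inverse u) (q ^ (n - s + 1))
                  (q ^ r1) (q ^ (n - r2))
                  (inverse q) (inverse q * u))))"
proof -
  interpret finite_dimensional_vector_space smul Basis by fact
  have n: "n = card Basis" using assms(2) by simp
  interpret decomposed_grassmannians smul Basis U \<pi> W
    by unfold_locales (use assms(4) n in simp)
  note q = assms(3)
  show ?thesis
    unfolding n
  proof (rule conjI[OF _ conjI]; intro allI impI; elim conjE)
    fix r s \<phi> assume "r \<le> card Basis" "s \<le> min r (card Basis - r)" "\<phi> \<in> W r s"
    then show "laplacian smul r \<phi> = cscale (- mu q s (card Basis)) \<phi>"
      unfolding mu_eq[OF q] by (rule laplacian_W)
  next
    fix r1 r2 s \<Lambda>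
    assume *: "r1 \<le> card Basis" "r2 \<le> card Basis" "s \<le> NN (card Basis) r1 r2"
      "extended_equivariant smul r1 (W r1 s) r2 (W r2 s) \<Lambda>"
    show "\<forall>\<phi>\<in>VV smul r1. laplacian_op smul r2 \<Lambda> \<phi> + cscale (mu q s (card Basis)) (\<Lambda> \<phi>) = 0"
    proof
      fix \<phi> assume "\<phi> \<in> VV smul r1"
      then have "\<Lambda> \<phi> \<in> W r2 s" using extended_equivariant_image * by blast
      moreover have "s \<le> min r2 (card Basis - r2)" using *(3) by (simp add: NN_def)
      ultimately have "laplacian smul r2 (\<Lambda> \<phi>) = cscale (- mu q s (card Basis)) (\<Lambda> \<phi>)"
        unfolding mu_eq[OF q] using laplacian_W *(2) by blast
      then show "laplacian_op smul r2 \<Lambda> \<phi> + cscale (mu q s (card Basis)) (\<Lambda> \<phi>) = 0"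
        by (simp only: laplacian_op_def o_apply cfun.scale_minus_left left_minus)
    qed
  qed (rule hypergeometric_interpolant[OF norm_q[OF q]], assumption+,
      rule kernel_nonzero, assumption+, rule kernel_recurrence[OF q], assumption+)
qed

end
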